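(* Let $1 \leq \alpha \leq \beta \leq \gamma$ be cardinal numbers. There is a domain $R$ satisfying all of the following properties: (i) $R$ is a Bézout domain: every finitely generated ideal of $R$ is principal. (ii) $R$ has exactly $\alpha$ atoms, each of which is a maximal ideal. (iii) $R$ has exactly $\beta$ maximal ideals. (iv) $R$ has exactly $\gamma$ nonzero prime ideals. (v) $R$ is an atomic domain if and only if $\alpha = \beta = \gamma < \aleph_0$. (vi) $R$ is a Furstenberg domain if and only if $\alpha = \beta$. (vii) $R$ is semiprimitive if and only if $\beta \geq \aleph_0$.
   Context: Rings are commutative with $1$; a domain is a nonzero ring without zero divisors. An element of a domain is irreducible if it is a nonzero nonunit $x$ such that $x=yz$ implies $y$ or $z$ is a unit. An atom of $R$ is a principal ideal $(x)$ generated by an irreducible element $x$. An atomic domain is a domain in which every nonzero nonunit is a finite product of irreducible elements. A Furstenberg domain is a domain in which every nonzero nonunit is divisible by some irreducible element. A ring is semiprimitive if its Jacobson radical (the intersection of all its maximal ideals) is $(0)$. *)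

theory Defs
  imports "HOL-Algebra.Algebra"
begin

unbundle cardinal_syntax

text \<open>
  The library's \<open>ring_irreducible\<close> is phrased through proper factors; in a domain it is the usual
  condition on factorizations.
\<close>
lemma (in domain) ring_irreducible_iff:
  assumes "x \<in> carrier R"
  shows "ring_irreducible x \<longleftrightarrow>
    x \<noteq> \<zero> \<and> x \<notin> Units R \<and>
    (\<forall>y\<in>carrier R. \<forall>z\<in>carrier R. x = y \<otimes> z \<longrightarrow> y \<in> Units R \<or> z \<in> Units R)"
  using assms ring_irreducibleE[of x] ring_irreducibleI[of x] by blast

definition bezout_domain :: "('a, 'm) ring_scheme \<Rightarrow> bool" where
  "bezout_domain R \<longleftrightarrow> domain R \<and>
     (\<forall>S. finite S \<and> S \<subseteq> carrier R \<longrightarrow> principalideal (Idl\<^bsub>R\<^esub> S) R)"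

definition atoms :: "('a, 'm) ring_scheme \<Rightarrow> 'a set set" where
  "atoms R = {PIdl\<^bsub>R\<^esub> x | x. x \<in> carrier R \<and> ring_irreducible\<^bsub>R\<^esub> x}"

definition maximal_ideals :: "('a, 'm) ring_scheme \<Rightarrow> 'a set set" where
  "maximal_ideals R = {M. maximalideal M R}"

definition nonzero_prime_ideals :: "('a, 'm) ring_scheme \<Rightarrow> 'a set set" where
  "nonzero_prime_ideals R = {P. primeideal P R \<and> P \<noteq> {\<zero>\<^bsub>R\<^esub>}}"

definition atomic_domain :: "('a, 'm) ring_scheme \<Rightarrow> bool" where
  "atomic_domain R \<longleftrightarrow> domain R \<and>
     (\<forall>a \<in> carrier R. a \<noteq> \<zero>\<^bsub>R\<^esub> \<and> a \<notin> Units R \<longrightarrow>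
       (\<exists>xs. set xs \<subseteq> carrier R \<and> (\<forall>x\<in>set xs. ring_irreducible\<^bsub>R\<^esub> x) \<and>
             a = foldr (\<otimes>\<^bsub>R\<^esub>) xs \<one>\<^bsub>R\<^esub>))"

definition furstenberg_domain :: "('a, 'm) ring_scheme \<Rightarrow> bool" where
  "furstenberg_domain R \<longleftrightarrow> domain R \<and>
     (\<forall>a \<in> carrier R. a \<noteq> \<zero>\<^bsub>R\<^esub> \<and> a \<notin> Units R \<longrightarrow>
       (\<exists>x \<in> carrier R. ring_irreducible\<^bsub>R\<^esub> x \<and> x divides\<^bsub>R\<^esub> a))"

definition jacobson_radical :: "('a, 'm) ring_scheme \<Rightarrow> 'a set" where
  "jacobson_radical R = carrier R \<inter> \<Inter>(maximal_ideals R)"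

definition semiprimitive :: "('a, 'm) ring_scheme \<Rightarrow> bool" where
  "semiprimitive R \<longleftrightarrow> jacobson_radical R = {\<zero>\<^bsub>R\<^esub>}"

end

theory Submission
  imports Defs "HOL-Computational_Algebra.Fraction_Field"
begin

text \<open>
  The ring is a Bezout domain with a prescribed lattice-ordered group of divisibility, obtained by
  the Jaffard--Kaplansky--Ohm construction. Take index sets \<open>A \<subseteq> B \<subseteq> V\<close> of cardinalities
  \<open>\<alpha>, \<beta>, \<gamma>\<close> and split \<open>V\<close> into chains, one for each \<open>b \<in> B\<close>, of which \<open>b\<close> is the least dominant
  element. Let \<open>G\<close> be the group of finitely supported functions from \<open>V\<close> to the rationals that are
  integral on \<open>A\<close>; an element is nonnegative if its restriction to every chain is
  lexicographically nonnegative. On the integral group ring of \<open>G\<close>, sending an element to the meet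
  of its exponents is multiplicative (Gauss' lemma) and extends to the field of fractions \<open>K\<close>;
  the ring consists of the elements of \<open>K\<close> of nonnegative value.

  A nonzero prime ideal is determined by the indices \<open>v\<close> for which it contains an element of value
  the \<open>v\<close>-th unit vector; these form a segment of one chain, so the nonzero primes correspond to
  \<open>V\<close>. The maximal ones correspond to \<open>B\<close>, and among these the principal ones to \<open>A\<close>, because a
  dense group of values has no least positive element. The atomic, Furstenberg and semiprimitive
  properties amount to \<open>A = V\<close>, \<open>A = B\<close> and \<open>B\<close> being infinite. When \<open>\<beta> = \<gamma>\<close> is infinite, one
  chooses \<open>B \<noteq> V\<close>.
\<close>

section \<open>Lexicographically ordered finitely supported functions\<close>

abbreviation lookup where "lookup \<equiv> Poly_Mapping.lookup"
abbreviation keys where "keys \<equiv> Poly_Mapping.keys"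
abbreviation single where "single \<equiv> Poly_Mapping.single"

lift_definition restr :: "'k set \<Rightarrow> ('k \<Rightarrow>\<^sub>0 'b) \<Rightarrow> 'k \<Rightarrow>\<^sub>0 'b::zero"
  is "\<lambda>S f k. if k \<in> S then f k else 0"
  by (erule rev_finite_subset) auto

lemma lookup_restr: "lookup (restr S f) k = (if k \<in> S then lookup f k else 0)"
  by (simp add: restr.rep_eq)

lemma keys_restr [simp]: "keys (restr S f) = keys f \<inter> S"
  by (auto simp: in_keys_iff lookup_restr split: if_splits)

lemma restr_zero [simp]: "restr S 0 = 0"
  by (rule poly_mapping_eqI) (simp add: lookup_restr)

lemma restr_add: "restr S (f + g) = restr S f + restr S (g :: 'k \<Rightarrow>\<^sub>0 'b::monoid_add)"
  by (rule poly_mapping_eqI) (simp add: lookup_restr lookup_add)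

lemma restr_minus: "restr S (f - g) = restr S f - restr S (g :: 'k \<Rightarrow>\<^sub>0 'b::ab_group_add)"
  by (rule poly_mapping_eqI) (simp add: lookup_restr lookup_minus)

lemma restr_single: "restr S (single k c) = (if k \<in> S then single k c else 0)"
  by (rule poly_mapping_eqI) (auto simp: lookup_restr lookup_single when_def)

lemma restr_eq_0_iff: "restr S f = 0 \<longleftrightarrow> keys f \<inter> S = {}"
  by (metis keys_eq_empty keys_restr)

section \<open>Lexicographic positivity\<close>

lemma pos_poly_mapping_iff:
  fixes f :: "'k::linorder \<Rightarrow>\<^sub>0 'b::linordered_ab_group_add"
  shows "0 < f \<longleftrightarrow> (\<exists>k. 0 < lookup f k \<and> (\<forall>k'<k. lookup f k' = 0))"
  by (auto simp: less_poly_mapping.rep_eq less_fun_def)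

lemma nonneg_poly_mappingI:
  fixes f :: "'k::linorder \<Rightarrow>\<^sub>0 'b::linordered_ab_group_add"
  assumes "\<And>k. lookup f k \<noteq> 0 \<Longrightarrow> (\<And>k'. k' < k \<Longrightarrow> lookup f k' = 0) \<Longrightarrow> 0 < lookup f k"
  shows "0 \<le> f"
proof (rule ccontr)
  assume "\<not> 0 \<le> f"
  hence "f < 0" by simp
  then obtain k where "lookup f k < 0" "\<forall>k'<k. lookup f k' = 0"
    by (auto simp: less_poly_mapping.rep_eq less_fun_def)
  thus False using assms[of k] by (metis less_irrefl less_trans)
qed

text \<open>If \<open>restr S' f\<close> is nonzero, the leading index of \<open>restr S f\<close>
  is at most one of its keys, hence lies in the initial segment \<open>S'\<close> and keeps its
  positive coefficient there.\<close>

lemma restr_initial_nonneg: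
  fixes f :: "'k::linorder \<Rightarrow>\<^sub>0 'b::linordered_ab_group_add"
  assumes "0 \<le> restr S f" and "S' \<subseteq> S" and "\<And>u w. w \<in> S' \<Longrightarrow> u \<in> S \<Longrightarrow> u \<le> w \<Longrightarrow> u \<in> S'"
  shows "0 \<le> restr S' f"
proof (cases "restr S' f = 0")
  case False
  hence "restr S f \<noteq> 0" using assms(2) by (auto simp: restr_eq_0_iff)
  hence "0 < restr S f" using assms(1) by simp
  then obtain k where k: "0 < lookup (restr S f) k" "\<forall>k'<k. lookup (restr S f) k' = 0"
    by (auto simp: pos_poly_mapping_iff)
  obtain w where w: "w \<in> S'" "lookup f w \<noteq> 0"
    using False by (metis lookup_restr poly_mapping_eqI lookup_zero)
  have "k \<le> w" using k(2) w assms(2) by (metis lookup_restr not_le subsetD)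
  have kS: "k \<in> S" "0 < lookup f k" using k(1) by (auto simp: lookup_restr split: if_splits)
  hence "k \<in> S'" using assms(3)[OF w(1)] \<open>k \<le> w\<close> by blast
  hence "0 < restr S' f" unfolding pos_poly_mapping_iff using kS k(2) assms(2)
    by (intro exI[of _ k]) (auto simp: lookup_restr split: if_splits)
  thus ?thesis by simp
qed simp

lemma single_nonneg_iff [simp]:
  "0 \<le> single k c \<longleftrightarrow> 0 \<le> (c :: 'b::linordered_ab_group_add)" for k :: "'k::linorder"
proof
  assume "0 \<le> single k c"
  show "0 \<le> c"
  proof (rule ccontr)
    assume "\<not> 0 \<le> c"
    hence "0 < single k (- c)"
      unfolding pos_poly_mapping_iff by (intro exI[of _ k]) (auto simp: lookup_single when_def)
    thus False using \<open>0 \<le> single k c\<close> by (simp add: single_uminus)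
  qed
next
  assume "0 \<le> c"
  thus "0 \<le> single k c" by (intro nonneg_poly_mappingI) (auto simp: lookup_single when_def split: if_splits)
qed

section \<open>Minimal values of exponents in a group ring\<close>

lemma Min_keys_add:
  fixes h :: "'g \<Rightarrow> 't::linorder"
  assumes "p \<noteq> 0" "q \<noteq> 0" "p + q \<noteq> 0"
  shows "min (Min (h ` keys p)) (Min (h ` keys q)) \<le> Min (h ` keys (p + q))"
proof -
  have "keys (p + q) \<subseteq> keys p \<union> keys q" by (rule keys_add)
  hence "Min (h ` (keys p \<union> keys q)) \<le> Min (h ` keys (p + q))"
    using assms by (intro Min_antimono) auto
  thus ?thesis using assms by (simp add: image_Un Min_Un)
qed

text \<open>
  Only the products of monomials of minimal value contribute to the minimal value of the product,
  and they do not cancel because the group ring has no zero divisors.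
\<close>
lemma Min_keys_mult:
  fixes h :: "'g::linordered_ab_group_add \<Rightarrow> 't::linordered_ab_group_add"
    and p q :: "'g \<Rightarrow>\<^sub>0 'k::idom"
  assumes h: "\<And>a b. h (a + b) = h a + h b" and p: "p \<noteq> 0" and q: "q \<noteq> 0"
  shows "Min (h ` keys (p * q)) = Min (h ` keys p) + Min (h ` keys q)"
proof -
  define m where "m = Min (h ` keys p)"
  define n where "n = Min (h ` keys q)"
  have ge: "m \<le> h a" if "a \<in> keys p" for a unfolding m_def using that by simp
  have geq: "n \<le> h a" if "a \<in> keys q" for a unfolding n_def using that by simp
  have "m \<in> h ` keys p" unfolding m_def using p by (intro Min_in) auto
  moreover have "n \<in> h ` keys q" unfolding n_def using q by (intro Min_in) auto
  ultimately obtain a b where ab: "a \<in> keys p" "h a = m" "b \<in> keys q" "h b = n" by auto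
  define p0 where "p0 = restr {g. h g = m} p"
  define q0 where "q0 = restr {g. h g = n} q"
  have "p0 \<noteq> 0" "q0 \<noteq> 0" using ab by (auto simp: p0_def q0_def restr_eq_0_iff)
  \<comment> \<open>The exponents form a totally ordered group, which makes the group ring an
    integral domain.\<close>
  hence "p0 * q0 \<noteq> 0" by simp
  then obtain k where k: "k \<in> keys (p0 * q0)" by (metis keys_eq_empty ex_in_conv)
  have "keys (p0 * q0) \<subseteq> {a + b |a b. a \<in> keys p0 \<and> b \<in> keys q0}" by (rule keys_mult)
  with k have hk: "h k = m + n" by (auto simp: p0_def q0_def h)
  have kp1: "keys (p - p0) \<subseteq> {g \<in> keys p. h g \<noteq> m}"
    by (auto simp: in_keys_iff lookup_minus p0_def lookup_restr split: if_splits)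
  have kq1: "keys (q - q0) \<subseteq> {g \<in> keys q. h g \<noteq> n}"
    by (auto simp: in_keys_iff lookup_minus q0_def lookup_restr split: if_splits)
  have "k \<notin> keys (p0 * (q - q0))"
  proof
    assume "k \<in> keys (p0 * (q - q0))"
    then obtain a b where "k = a + b" "a \<in> keys p0" "b \<in> keys (q - q0)" using keys_mult by blast
    with kq1 have "h a = m" "n \<le> h b" "h b \<noteq> n" by (auto simp: p0_def geq)
    with hk \<open>k = a + b\<close> show False by (simp add: h)
  qed
  moreover have "k \<notin> keys ((p - p0) * q)"
  proof
    assume "k \<in> keys ((p - p0) * q)"
    then obtain a b where "k = a + b" "a \<in> keys (p - p0)" "b \<in> keys q" using keys_mult by blast
    with kp1 have "m \<le> h a" "h a \<noteq> m" "n \<le> h b" by (auto simp: ge geq)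
    hence "m + n < h a + h b" by (simp add: add_less_le_mono)
    with hk \<open>k = a + b\<close> show False by (simp add: h)
  qed
  moreover have "p * q = p0 * q0 + (p0 * (q - q0) + (p - p0) * q)" by (simp add: algebra_simps)
  ultimately have "lookup (p * q) k \<noteq> 0" using k by (simp add: lookup_add in_keys_iff)
  hence "m + n \<in> h ` keys (p * q)" using hk by (metis image_eqI in_keys_iff)
  moreover have "m + n \<le> h g" if g: "g \<in> keys (p * q)" for g
  proof -
    obtain a b where "g = a + b" "a \<in> keys p" "b \<in> keys q" using g keys_mult[of p q] by blast
    thus ?thesis by (simp add: h ge geq add_mono)
  qed
  ultimately show ?thesis unfolding m_def[symmetric] n_def[symmetric] by (intro Min_eqI) auto
qed

section \<open>The group of divisibility\<close>

text \<open>
  The order is that of the lexicographic order on finitely supported functions, in which the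
  \<^emph>\<open>least\<close> differing index decides. Hence \<open>T v\<close>, an initial segment of a chain, consists of the
  indices that dominate \<open>v\<close>, and \<open>v\<close> itself carries the smallest values within \<open>T v\<close>.
\<close>
locale root_forest =
  fixes V A B :: "'v::linorder set" and T :: "'v \<Rightarrow> 'v set"
  assumes A_subset: "A \<subseteq> B" and B_subset: "B \<subseteq> V"
    and T_subset: "v \<in> V \<Longrightarrow> T v \<subseteq> V"
    and T_refl: "v \<in> V \<Longrightarrow> v \<in> T v"
    and T_le: "v \<in> V \<Longrightarrow> u \<in> T v \<Longrightarrow> u \<le> v"
    and T_initial: "v \<in> V \<Longrightarrow> w \<in> T v \<Longrightarrow> T w = {u \<in> T v. u \<le> w}"
    and T_root: "v \<in> V \<Longrightarrow> \<exists>b\<in>B. v \<in> T b"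
    and T_disjoint: "b \<in> B \<Longrightarrow> b' \<in> B \<Longrightarrow> b \<noteq> b' \<Longrightarrow> T b \<inter> T b' = {}"
    and V_greatest: "S \<subseteq> V \<Longrightarrow> S \<noteq> {} \<Longrightarrow> \<exists>m\<in>S. \<forall>s\<in>S. s \<le> m"
begin

definition G :: "('v \<Rightarrow>\<^sub>0 rat) set" where
  "G = {g. keys g \<subseteq> V \<and> (\<forall>a\<in>A. lookup g a \<in> \<int>)}"

definition nonneg :: "('v \<Rightarrow>\<^sub>0 rat) \<Rightarrow> bool" where
  "nonneg g \<longleftrightarrow> (\<forall>b\<in>B. 0 \<le> restr (T b) g)"

lemma G_zero [simp]: "0 \<in> G"
  by (simp add: G_def)

lemma G_add: "g \<in> G \<Longrightarrow> h \<in> G \<Longrightarrow> g + h \<in> G"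
  unfolding G_def using keys_add[of g h] by (auto simp: lookup_add)

lemma G_minus: "g \<in> G \<Longrightarrow> h \<in> G \<Longrightarrow> g - h \<in> G"
  unfolding G_def using keys_diff[of g h] by (auto simp: lookup_minus)

lemma G_sum: "(\<And>i. i \<in> I \<Longrightarrow> f i \<in> G) \<Longrightarrow> sum f I \<in> G"
  by (induction I rule: infinite_finite_induct) (auto intro: G_add)

lemma single_in_G: "v \<in> V \<Longrightarrow> v \<notin> A \<or> c \<in> \<int> \<Longrightarrow> single v c \<in> G"
  unfolding G_def by (auto simp: lookup_single when_def)

lemma nonneg_zero [simp]: "nonneg 0"
  by (simp add: nonneg_def)

lemma nonneg_add: "nonneg g \<Longrightarrow> nonneg h \<Longrightarrow> nonneg (g + h)"
  by (simp add: nonneg_def restr_add)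

lemma nonneg_sum: "(\<And>i. i \<in> I \<Longrightarrow> nonneg (f i)) \<Longrightarrow> nonneg (sum f I)"
  by (induction I rule: infinite_finite_induct) (auto intro: nonneg_add)

lemma nonneg_single: "0 \<le> c \<Longrightarrow> nonneg (single v c)"
  by (simp add: nonneg_def restr_single)

lemma nonneg_restr:
  assumes "nonneg g" "v \<in> V" shows "0 \<le> restr (T v) g"
proof -
  obtain b where b: "b \<in> B" "v \<in> T b" using T_root assms(2) by blast
  have "T v = {u \<in> T b. u \<le> v}" using T_initial b B_subset by blast
  moreover have "0 \<le> restr (T b) g" using assms(1) b by (simp add: nonneg_def)
  ultimately show ?thesis by (auto intro: restr_initial_nonneg[of "T b"])
qed

lemma T_antisym: "u \<in> V \<Longrightarrow> v \<in> V \<Longrightarrow> u \<in> T v \<Longrightarrow> v \<in> T u \<Longrightarrow> u = v"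
  by (metis T_le antisym)

lemma T_mono: "v \<in> V \<Longrightarrow> w \<in> T v \<Longrightarrow> T w \<subseteq> T v"
  using T_initial by blast

text \<open>A root \<open>b'\<close> whose chain contains \<open>v\<close> has \<open>b\<close> in
  \<open>T b'\<close> as well as in \<open>T b\<close>, so disjointness gives \<open>b' = b\<close>;
  then \<open>v\<close> and \<open>b\<close> dominate each other.\<close>

lemma B_maximal: "b \<in> B \<Longrightarrow> v \<in> V \<Longrightarrow> b \<in> T v \<Longrightarrow> v = b"
proof -
  assume b: "b \<in> B" and v: "v \<in> V" "b \<in> T v"
  obtain b' where b': "b' \<in> B" "v \<in> T b'" using T_root[OF v(1)] by blast
  have "b \<in> T b'" using T_mono[of b' v] b' v B_subset by blast
  moreover have "b \<in> T b" using T_refl b B_subset by blast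
  ultimately have "b' = b" using T_disjoint[OF b b'(1)] by blast
  thus "v = b" using T_antisym[of b v] b v b' B_subset by blast
qed

text \<open>By \<open>T_root\<close> the chains of the roots cover \<open>V\<close>, so a function
  in \<open>G\<close> that vanishes on each of them is zero.\<close>

lemma G_antisym:
  assumes "g \<in> G" "nonneg g" "nonneg (- g)" shows "g = 0"
proof -
  have "restr (T b) g = 0" if "b \<in> B" for b
  proof -
    have "restr (T b) (- g) = - restr (T b) g"
      using restr_minus[of "T b" 0 g] by simp
    moreover have "0 \<le> restr (T b) (- g)" "0 \<le> restr (T b) g"
      using assms that by (simp_all add: nonneg_def)
    ultimately show ?thesis by simp
  qed
  moreover have "v \<in> V" if "v \<in> keys g" for v using that assms(1) by (auto simp: G_def)
  ultimately have "v \<notin> keys g" for v using T_root[of v] by (auto simp: restr_eq_0_iff)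
  thus ?thesis by (metis keys_eq_empty ex_in_conv)
qed

lemma pos_exists_root:
  assumes "g \<in> G" "g \<noteq> 0" shows "\<exists>b\<in>B. keys g \<inter> T b \<noteq> {}"
proof -
  obtain v where "v \<in> keys g" using assms(2) by (metis keys_eq_empty ex_in_conv)
  thus ?thesis using assms(1) T_root[of v] by (auto simp: G_def)
qed

text \<open>For \<open>w < v\<close> the sign is decided at \<open>w\<close>, which lies in every
  root chain containing \<open>v\<close>; any positive \<open>c\<close> there outweighs the unit at
  \<open>v\<close>. With \<open>c = 1\<close> this yields that \<open>e v\<close> divides
  \<open>e w\<close>.\<close>

lemma nonneg_single_diff:
  assumes "v \<in> V" "w \<in> T v" "0 < c" "w = v \<Longrightarrow> 1 \<le> c"
  shows "nonneg (single w c - single v 1)"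
proof (cases "w = v")
  case True
  thus ?thesis using assms by (simp add: nonneg_single flip: single_diff)
next
  case False
  hence lt: "w < v" using T_le assms by force
  show ?thesis unfolding nonneg_def
  proof
    fix b assume b: "b \<in> B"
    have sub: "w \<in> T b" if "v \<in> T b" using T_mono[of b v] b B_subset assms that by blast
    have L: "lookup (restr (T b) (single w c - single v 1)) k =
        (if k \<notin> T b then 0 else if k = w then c else if k = v then - 1 else 0)" for k
      using lt by (auto simp: lookup_restr lookup_minus lookup_single when_def)
    show "0 \<le> restr (T b) (single w c - single v 1)"
    proof (rule nonneg_poly_mappingI)
      fix k assume k: "lookup (restr (T b) (single w c - single v 1)) k \<noteq> 0"
        and z: "\<And>k'. k' < k \<Longrightarrow> lookup (restr (T b) (single w c - single v 1)) k' = 0"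
      have "k \<in> T b" using k unfolding L by metis
      moreover have "k = w"
      proof (rule ccontr)
        assume "k \<noteq> w"
        hence "k = v" using k unfolding L by metis
        hence "c = 0" using z[of w] L[of w] sub lt \<open>k \<in> T b\<close> by simp
        thus False using assms(3) by simp
      qed
      ultimately show "0 < lookup (restr (T b) (single w c - single v 1)) k"
        unfolding L using assms(3) by simp
    qed
  qed
qed

lemma leading_index:
  assumes "nonneg g" "v \<in> V" "keys g \<inter> T v \<noteq> {}"
  obtains w where "w \<in> T v" "0 < lookup g w" "\<And>u. u \<in> T w \<Longrightarrow> u \<noteq> w \<Longrightarrow> lookup g u = 0"
proof -
  have "restr (T v) g \<noteq> 0" using assms by (simp add: restr_eq_0_iff)
  hence "0 < restr (T v) g" using nonneg_restr assms by (metis order_le_less)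
  then obtain w where w: "0 < lookup (restr (T v) g) w" "\<And>u. u < w \<Longrightarrow> lookup (restr (T v) g) u = 0"
    by (auto simp: pos_poly_mapping_iff)
  have "w \<in> T v" "0 < lookup g w" using w(1) by (auto simp: lookup_restr split: if_splits)
  moreover have "lookup g u = 0" if "u \<in> T w" "u \<noteq> w" for u
  proof -
    have "u \<in> T v" "u < w" using that T_initial[OF assms(2) \<open>w \<in> T v\<close>] by auto
    thus ?thesis using w(2)[of u] by (simp add: lookup_restr)
  qed
  ultimately show ?thesis by (rule that)
qed

text \<open>On a root chain through \<open>w\<close>, \<open>g\<close> vanishes below
  \<open>w\<close>. If \<open>c\<close> is smaller than the coefficient of \<open>g\<close>, the
  difference leads at \<open>w\<close> with a positive coefficient; if it is equal, \<open>w\<close>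
  is the last index of its chain and the difference vanishes there.\<close>

lemma nonneg_diff_single:
  assumes g: "nonneg g" and w: "w \<in> V" and c: "c < lookup g w \<or> c = lookup g w \<and> w \<in> B"
    and T: "\<And>u. u \<in> T w \<Longrightarrow> u \<noteq> w \<Longrightarrow> lookup g u = 0"
  shows "nonneg (g - single w c)"
  unfolding nonneg_def
proof
  fix b assume b: "b \<in> B"
  show "0 \<le> restr (T b) (g - single w c)"
  proof (cases "w \<in> T b")
    case False
    thus ?thesis using g b by (simp add: restr_minus restr_single nonneg_def)
  next
    case True
    have Tw: "T w = {u \<in> T b. u \<le> w}" using T_initial b B_subset True by blast
    have z: "lookup g u = 0" if "u \<in> T b" "u < w" for u using T[of u] that Tw by auto
    show ?thesis
    proof (cases "c < lookup g w")
      case True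
      show ?thesis
      proof (rule nonneg_poly_mappingI)
        fix k assume k: "lookup (restr (T b) (g - single w c)) k \<noteq> 0"
          "\<And>k'. k' < k \<Longrightarrow> lookup (restr (T b) (g - single w c)) k' = 0"
        have "k \<in> T b" using k(1) by (auto simp: lookup_restr split: if_splits)
        have "\<not> w < k" using k(2)[of w] True \<open>w \<in> T b\<close> by (auto simp: lookup_restr lookup_minus)
        moreover have "\<not> k < w" using k(1) z[of k] \<open>k \<in> T b\<close>
          by (auto simp: lookup_restr lookup_minus lookup_single when_def split: if_splits)
        ultimately have "k = w" by simp
        thus "0 < lookup (restr (T b) (g - single w c)) k"
          using True \<open>w \<in> T b\<close> by (simp add: lookup_restr lookup_minus)
      qed
    next
      case False
      hence "b = w" "c = lookup g w" using c B_maximal[of w b] b B_subset \<open>w \<in> T b\<close> by auto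
      hence "restr (T b) (g - single w c) = 0"
        using T by (intro poly_mapping_eqI) (auto simp: lookup_restr lookup_minus lookup_single when_def)
      thus ?thesis by simp
    qed
  qed
qed

lemma lookup_sum_const: "lookup (\<Sum>i<N. g) k = of_nat N * (lookup g k :: rat)" for N :: nat
  by (simp add: lookup_sum)

text \<open>The leading coefficient may be below 1, so an archimedean multiple is taken. On the ring
  side, a power of an element becomes divisible by some \<open>e w\<close>.\<close>

lemma nonneg_multiple_diff_single:
  assumes "nonneg g" "v \<in> V" "keys g \<inter> T v \<noteq> {}"
  shows "\<exists>w\<in>T v. \<exists>N::nat. nonneg ((\<Sum>i<N. g) - single w 1)"
proof -
  obtain w where w: "w \<in> T v" "0 < lookup g w" "\<And>u. u \<in> T w \<Longrightarrow> u \<noteq> w \<Longrightarrow> lookup g u = 0"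
    using leading_index[OF assms] by blast
  obtain N :: nat where N: "1 < of_nat N * lookup g w"
    using w(2) ex_less_of_nat_mult by blast
  have "nonneg ((\<Sum>i<N. g) - single w 1)"
    using assms N w T_subset[OF assms(2)]
    by (intro nonneg_diff_single) (auto simp: lookup_sum_const nonneg_sum)
  thus ?thesis using w(1) by blast
qed

text \<open>The leading index of \<open>g\<close> on \<open>T b\<close> is either \<open>b\<close>,
  whose coefficient serves as \<open>c\<close> (or 1, by integrality, if \<open>b\<close> is in
  \<open>A\<close>), or it strictly dominates \<open>b\<close> and outweighs the unit there. The
  value 1 on \<open>A\<close> is what makes \<open>e b\<close> divide every element of
  \<open>prime_at b\<close>.\<close>

lemma root_single_le:
  assumes "nonneg g" "g \<in> G" "b \<in> B" "keys g \<inter> T b \<noteq> {}"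
  shows "\<exists>c>0. nonneg (g - single b c) \<and> (b \<in> A \<longrightarrow> c = 1)"
proof -
  have bV: "b \<in> V" using assms(3) B_subset by auto
  obtain w where w: "w \<in> T b" "0 < lookup g w" "\<And>u. u \<in> T w \<Longrightarrow> u \<noteq> w \<Longrightarrow> lookup g u = 0"
    using leading_index[OF assms(1) bV assms(4)] by blast
  show ?thesis
  proof (cases "w = b \<and> b \<in> A")
    case True
    hence "lookup g b \<in> \<int>" using assms(2) by (simp add: G_def)
    then obtain n where n: "lookup g b = of_int n" by (elim Ints_cases)
    hence "1 \<le> lookup g b" using w(2) True by simp
    hence "nonneg (g - single b 1)"
      using True w assms bV by (intro nonneg_diff_single) auto
    thus ?thesis by (intro exI[of _ 1]) auto
  next
    case F: False
    show ?thesis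
    proof (cases "w = b")
      case True
      hence "nonneg (g - single b (lookup g b))"
        using w assms bV by (intro nonneg_diff_single) auto
      thus ?thesis using F True w(2) by (intro exI[of _ "lookup g b"]) auto
    next
      case False
      have wV: "w \<in> V" using w(1) T_subset bV by auto
      \<comment> \<open>Splitting the coefficient at \<open>w\<close> in half leaves both parts
        positive at \<open>w\<close>: one keeps the remainder nonnegative, the other outweighs the
        unit at \<open>b\<close>.\<close>
      have "nonneg (g - single w (lookup g w / 2))"
        using w assms wV by (intro nonneg_diff_single) auto
      moreover have "nonneg (single w (lookup g w / 2) - single b 1)"
        using False w bV by (intro nonneg_single_diff) auto
      ultimately have "nonneg ((g - single w (lookup g w / 2)) + (single w (lookup g w / 2) - single b 1))"
        by (rule nonneg_add)
      thus ?thesis by (intro exI[of _ 1]) simp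
    qed
  qed
qed

text \<open>On root chains other than \<open>T a\<close> the element \<open>g\<close> is squeezed
  between 0 and 0, so it has a key in \<open>T a\<close>. Then \<open>root_single_le\<close> puts
  \<open>single a 1\<close> below \<open>g\<close>, and antisymmetry finishes.\<close>

lemma single_root_minimal:
  assumes "g \<in> G" "nonneg g" "a \<in> A" "nonneg (single a 1 - g)" "g \<noteq> 0"
  shows "g = single a 1"
proof -
  have aB: "a \<in> B" and aV: "a \<in> V" using assms(3) A_subset B_subset by auto
  obtain b where b: "b \<in> B" "keys g \<inter> T b \<noteq> {}" using pos_exists_root assms by blast
  have "b = a"
  proof (rule ccontr)
    assume "b \<noteq> a"
    hence "a \<notin> T b" using B_maximal[of a b] aB b B_subset by blast
    hence "0 \<le> - restr (T b) g"
      using assms(4) b by (force simp: nonneg_def restr_minus restr_single)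
    moreover have "0 \<le> restr (T b) g" using assms(2) b by (simp add: nonneg_def)
    ultimately have "restr (T b) g = 0" by simp
    thus False using b by (simp add: restr_eq_0_iff)
  qed
  hence "nonneg (g - single a 1)" using root_single_le[OF assms(2,1) b] assms(3) by auto
  moreover have "g - single a 1 \<in> G"
    using assms aV by (intro G_minus single_in_G) auto
  ultimately have "g - single a 1 = 0" using assms(4) by (intro G_antisym) auto
  thus ?thesis by simp
qed

text \<open>A pointwise nonnegative vector is nonnegative on every chain, so a common bound for the
  coefficients suffices. The bound is the value of a product of powers of the \<open>e v\<close>, to
  which questions about primes are thereby reduced.\<close>

lemma nonneg_bound:
  assumes "g \<in> G" shows "\<exists>N::nat. nonneg ((\<Sum>v\<in>keys g. single v (of_nat N)) - g)"
proof -
  define M where "M = (\<Sum>v\<in>keys g. \<bar>lookup g v\<bar>)"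
  obtain N :: nat where N: "M \<le> of_nat N" using real_arch_simple[of M] by blast
  have le: "lookup g v \<le> of_nat N" if "v \<in> keys g" for v
  proof -
    have "\<bar>lookup g v\<bar> \<le> M" unfolding M_def using that by (intro member_le_sum) auto
    thus ?thesis using N by linarith
  qed
  have "lookup (\<Sum>v\<in>keys g. single v (of_nat N)) k = (if k \<in> keys g then of_nat N else 0 :: rat)" for k
    by (simp add: lookup_sum lookup_single when_def)
  hence "0 \<le> lookup ((\<Sum>v\<in>keys g. single v (of_nat N)) - g) k" for k
    using le[of k] by (auto simp: lookup_minus in_keys_iff)
  hence "0 \<le> restr S ((\<Sum>v\<in>keys g. single v (of_nat N)) - g)" for S
    by (intro nonneg_poly_mappingI) (auto simp: lookup_restr order_less_le)
  thus ?thesis by (auto simp: nonneg_def)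
qed

end

section \<open>Domains with the given group of divisibility\<close>

text \<open>These properties of the value map carry all the ideal theory below. The order on
  \<open>G\<close> given by \<open>nonneg\<close> is only partial, so the inequality for sums is
  stated on each chain \<open>T b\<close>. In \<open>val_bezout\<close>, the combination is a common
  divisor lying in the ideal of \<open>x\<close> and \<open>y\<close>.\<close>

locale forest_semivaluation = root_forest V A B T + domain R
  for V A B :: "'v::linorder set" and T and R :: "('r, 'm) ring_scheme" (structure) +
  fixes \<phi> :: "'r \<Rightarrow> 'v \<Rightarrow>\<^sub>0 rat"
  assumes val_G: "x \<in> carrier R - {\<zero>} \<Longrightarrow> \<phi> x \<in> G"
    and val_nonneg: "x \<in> carrier R - {\<zero>} \<Longrightarrow> nonneg (\<phi> x)"
    and val_mult: "x \<in> carrier R - {\<zero>} \<Longrightarrow> y \<in> carrier R - {\<zero>} \<Longrightarrow> \<phi> (x \<otimes> y) = \<phi> x + \<phi> y"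
    and val_add: "x \<in> carrier R - {\<zero>} \<Longrightarrow> y \<in> carrier R - {\<zero>} \<Longrightarrow> x \<oplus> y \<noteq> \<zero> \<Longrightarrow> b \<in> B \<Longrightarrow>
      min (restr (T b) (\<phi> x)) (restr (T b) (\<phi> y)) \<le> restr (T b) (\<phi> (x \<oplus> y))"
    and val_surj: "g \<in> G \<Longrightarrow> nonneg g \<Longrightarrow> \<exists>x\<in>carrier R - {\<zero>}. \<phi> x = g"
    and val_divides: "x \<in> carrier R - {\<zero>} \<Longrightarrow> y \<in> carrier R - {\<zero>} \<Longrightarrow>
      nonneg (\<phi> y - \<phi> x) \<Longrightarrow> x divides y"
    and val_bezout: "x \<in> carrier R - {\<zero>} \<Longrightarrow> y \<in> carrier R - {\<zero>} \<Longrightarrow>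
      \<exists>c\<in>carrier R. \<exists>d\<in>carrier R. (c \<otimes> x \<oplus> d \<otimes> y) divides x \<and> (c \<otimes> x \<oplus> d \<otimes> y) divides y"
begin

section \<open>Divisibility and units through values\<close>

lemma mult_nonzero: "x \<in> carrier R - {\<zero>} \<Longrightarrow> y \<in> carrier R - {\<zero>} \<Longrightarrow> x \<otimes> y \<in> carrier R - {\<zero>}"
  using integral by auto

lemma one_nonzero: "\<one> \<in> carrier R - {\<zero>}"
  by simp

lemma val_one [simp]: "\<phi> \<one> = 0"
  using val_mult[OF one_nonzero one_nonzero] by simp

lemma divides_iff_val:
  assumes "x \<in> carrier R - {\<zero>}" "y \<in> carrier R - {\<zero>}"
  shows "x divides y \<longleftrightarrow> nonneg (\<phi> y - \<phi> x)"
proof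
  assume "x divides y"
  then obtain z where z: "z \<in> carrier R" "y = x \<otimes> z" by (auto simp: factor_def)
  hence "z \<in> carrier R - {\<zero>}" using assms by auto
  thus "nonneg (\<phi> y - \<phi> x)" using z assms by (simp add: val_mult val_nonneg)
qed (use val_divides assms in blast)

lemma Units_iff_val:
  assumes "x \<in> carrier R - {\<zero>}" shows "x \<in> Units R \<longleftrightarrow> \<phi> x = 0"
proof
  assume "x \<in> Units R"
  hence "x divides \<one>" using one_nonzero assms
    by (metis DiffD1 unit_divides one_closed)
  hence "nonneg (- \<phi> x)" using divides_iff_val[OF assms one_nonzero] by simp
  thus "\<phi> x = 0" using val_nonneg[OF assms] val_G[OF assms] by (intro G_antisym)
next
  assume "\<phi> x = 0"
  hence "x divides \<one>" using divides_iff_val[OF assms one_nonzero] by simp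
  thus "x \<in> Units R" using assms by (metis DiffD1 divides_unit Units_one_closed)
qed

lemma val_pow:
  assumes "x \<in> carrier R - {\<zero>}"
  shows "x [^] (n::nat) \<in> carrier R - {\<zero>} \<and> \<phi> (x [^] n) = (\<Sum>i<n. \<phi> x)"
proof (induction n)
  case (Suc n)
  thus ?case using assms mult_nonzero[of "x [^] n" x] by (simp add: val_mult)
qed simp

section \<open>Prime ideals attached to the indices\<close>

definition e :: "'v \<Rightarrow> 'r" where
  "e v = (SOME x. x \<in> carrier R - {\<zero>} \<and> \<phi> x = single v 1)"

lemma e_props: assumes "v \<in> V" shows "e v \<in> carrier R - {\<zero>}" "\<phi> (e v) = single v 1"
proof -
  have "\<exists>x. x \<in> carrier R - {\<zero>} \<and> \<phi> x = single v 1"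
    using val_surj[OF single_in_G nonneg_single, of v 1] assms by auto
  hence "e v \<in> carrier R - {\<zero>} \<and> \<phi> (e v) = single v 1" unfolding e_def by (rule someI_ex)
  thus "e v \<in> carrier R - {\<zero>}" "\<phi> (e v) = single v 1" by auto
qed

text \<open>The centre of the valuation obtained by restricting \<phi> to \<open>T v\<close>: values
  are nonnegative, so a key in \<open>T v\<close> means a strictly positive restriction. Zero is
  listed separately because its value is unspecified.\<close>

definition prime_at :: "'v \<Rightarrow> 'r set" where
  "prime_at v = {x \<in> carrier R. x = \<zero> \<or> keys (\<phi> x) \<inter> T v \<noteq> {}}"

lemma not_mem_prime_atD:
  assumes "x \<in> carrier R" "x \<notin> prime_at v"
  shows "x \<in> carrier R - {\<zero>}" "keys (\<phi> x) \<inter> T v = {}"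
  using assms by (auto simp: prime_at_def)

lemma ideal_divides: "ideal I R \<Longrightarrow> x \<in> I \<Longrightarrow> x divides y \<Longrightarrow> y \<in> I"
  by (auto simp: factor_def intro: ideal.I_r_closed)

lemma mem_prime_at_divides:
  assumes "v \<in> V" "x \<in> carrier R - {\<zero>}" "y \<in> carrier R - {\<zero>}" "x \<in> prime_at v"
    and "0 \<le> restr (T v) (\<phi> y - \<phi> x)"
  shows "y \<in> prime_at v"
proof -
  have "restr (T v) (\<phi> x) \<noteq> 0" using assms by (auto simp: prime_at_def restr_eq_0_iff)
  hence "0 < restr (T v) (\<phi> x)" using nonneg_restr[OF val_nonneg] assms by (metis order_le_less)
  also have "\<dots> \<le> restr (T v) (\<phi> y)" using assms(5) by (simp add: restr_minus)
  finally show ?thesis using assms by (auto simp: prime_at_def simp flip: restr_eq_0_iff)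
qed

lemma prime_at_add:
  assumes v: "v \<in> V" and x: "x \<in> prime_at v" and y: "y \<in> prime_at v"
  shows "x \<oplus> y \<in> prime_at v"
proof -
  have c: "x \<in> carrier R" "y \<in> carrier R" using x y by (auto simp: prime_at_def)
  consider "x = \<zero>" | "y = \<zero>" | "x \<oplus> y = \<zero>"
    | "x \<in> carrier R - {\<zero>}" "y \<in> carrier R - {\<zero>}" "x \<oplus> y \<in> carrier R - {\<zero>}"
    using c by auto
  thus ?thesis
  proof cases
    case 4
    obtain b where b: "b \<in> B" "v \<in> T b" using T_root[OF v] by blast
    have Tv: "T v = {u \<in> T b. u \<le> v}" using T_initial b B_subset by blast
    have "min (restr (T b) (\<phi> x)) (restr (T b) (\<phi> y)) \<le> restr (T b) (\<phi> (x \<oplus> y))"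
      using val_add 4 b by auto
    \<comment> \<open>The minimum is one of the two values, and the resulting comparison on
      \<open>T b\<close> passes to its initial segment \<open>T v\<close>.\<close>
    then consider "0 \<le> restr (T b) (\<phi> (x \<oplus> y) - \<phi> x)" | "0 \<le> restr (T b) (\<phi> (x \<oplus> y) - \<phi> y)"
      by (auto simp: restr_minus min_le_iff_disj)
    thus ?thesis
    proof cases
      case 1
      hence "0 \<le> restr (T v) (\<phi> (x \<oplus> y) - \<phi> x)"
        using Tv by (auto intro: restr_initial_nonneg[of "T b"])
      thus ?thesis using mem_prime_at_divides v x 4 by blast
    next
      case 2
      hence "0 \<le> restr (T v) (\<phi> (x \<oplus> y) - \<phi> y)"
        using Tv by (auto intro: restr_initial_nonneg[of "T b"])
      thus ?thesis using mem_prime_at_divides v y 4 by blast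
    qed
  qed (use x y c in \<open>auto simp: prime_at_def\<close>)
qed

lemma mult_mem_prime_at_iff:
  assumes v: "v \<in> V" and x: "x \<in> carrier R" and y: "y \<in> carrier R"
  shows "x \<otimes> y \<in> prime_at v \<longleftrightarrow> x \<in> prime_at v \<or> y \<in> prime_at v"
proof (cases "x = \<zero> \<or> y = \<zero>")
  case False
  hence nz: "x \<in> carrier R - {\<zero>}" "y \<in> carrier R - {\<zero>}" "x \<otimes> y \<in> carrier R - {\<zero>}"
    using x y mult_nonzero by auto
  have "0 \<le> restr (T v) (\<phi> x)" "0 \<le> restr (T v) (\<phi> y)"
    using nz v by (auto intro: nonneg_restr val_nonneg)
  hence "restr (T v) (\<phi> x + \<phi> y) = 0 \<longleftrightarrow> restr (T v) (\<phi> x) = 0 \<and> restr (T v) (\<phi> y) = 0"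
    by (simp add: restr_add add_nonneg_eq_0_iff)
  thus ?thesis using nz by (auto simp: prime_at_def val_mult simp flip: restr_eq_0_iff)
qed (use x y in \<open>auto simp: prime_at_def\<close>)

lemma e_mem_prime_at: "u \<in> V \<Longrightarrow> v \<in> V \<Longrightarrow> e u \<in> prime_at v \<longleftrightarrow> u \<in> T v"
  using e_props[of u] by (auto simp: prime_at_def)

lemma primeideal_prime_at:
  assumes v: "v \<in> V" shows "primeideal (prime_at v) R"
proof (rule primeidealI)
  show "ideal (prime_at v) R"
  proof (rule idealI)
    show "subgroup (prime_at v) (add_monoid R)"
    proof (rule add.subgroupI)
      show "\<ominus> a \<in> prime_at v" if "a \<in> prime_at v" for a
      proof -
        have a: "a \<in> carrier R" using that by (auto simp: prime_at_def)
        hence "\<ominus> a = (\<ominus> \<one>) \<otimes> a" by (simp add: l_minus)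
        thus ?thesis using mult_mem_prime_at_iff[OF v, of "\<ominus> \<one>" a] a that by simp
      qed
      show "prime_at v \<noteq> {}" using e_mem_prime_at T_refl v by blast
    qed (use prime_at_add v in \<open>auto simp: prime_at_def\<close>)
    show "x \<otimes> a \<in> prime_at v" if "a \<in> prime_at v" "x \<in> carrier R" for a x
      using that mult_mem_prime_at_iff[OF v, of x a] by (auto simp: prime_at_def)
    show "a \<otimes> x \<in> prime_at v" if "a \<in> prime_at v" "x \<in> carrier R" for a x
      using that mult_mem_prime_at_iff[OF v, of a x] by (auto simp: prime_at_def)
  qed (rule ring_axioms)
  show "carrier R \<noteq> prime_at v"
  proof
    assume "carrier R = prime_at v"
    hence "\<one> \<in> prime_at v" using one_closed by blast
    thus False by (simp add: prime_at_def)
  qed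
qed (use mult_mem_prime_at_iff v is_cring in auto)

lemma ideal_prime_at: "v \<in> V \<Longrightarrow> ideal (prime_at v) R"
  using primeideal_prime_at primeideal.axioms(1) by blast

lemma prime_at_nonzero: "v \<in> V \<Longrightarrow> prime_at v \<noteq> {\<zero>}"
  using e_mem_prime_at[of v v] e_props[of v] T_refl by auto

lemma inj_on_prime_at: "inj_on prime_at V"
  by (rule inj_onI) (metis T_antisym T_refl e_mem_prime_at)

text \<open>The Bezout combination \<open>z\<close> lies in \<open>I\<close>, and its value is
  bounded by those of \<open>x\<close> and \<open>y\<close>. On each root chain one of these
  vanishes, so \<open>z\<close> is a unit.\<close>

lemma coprime_unit:
  assumes I: "ideal I R" and xy: "x \<in> I" "y \<in> I" "x \<in> carrier R - {\<zero>}" "y \<in> carrier R - {\<zero>}"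
    and disj: "\<And>b. b \<in> B \<Longrightarrow> keys (\<phi> x) \<inter> T b = {} \<or> keys (\<phi> y) \<inter> T b = {}"
  shows "I = carrier R"
proof -
  interpret I: ideal I R by (rule I)
  obtain c d where cd: "c \<in> carrier R" "d \<in> carrier R"
    and dv: "(c \<otimes> x \<oplus> d \<otimes> y) divides x" "(c \<otimes> x \<oplus> d \<otimes> y) divides y"
    using val_bezout xy by blast
  define z where "z = c \<otimes> x \<oplus> d \<otimes> y"
  have zI: "z \<in> I" using cd xy by (simp add: z_def I.I_l_closed)
  have "z \<noteq> \<zero>"
    using dv(1) xy(3) unfolding z_def[symmetric] by (auto simp: factor_def)
  hence z: "z \<in> carrier R - {\<zero>}" using zI by auto
  have nn: "nonneg (\<phi> x - \<phi> z)" "nonneg (\<phi> y - \<phi> z)"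
    using dv z xy divides_iff_val unfolding z_def[symmetric] by auto
  have "restr (T b) (\<phi> z) = 0" if b: "b \<in> B" for b
  proof -
    have "0 \<le> restr (T b) (\<phi> z)" using val_nonneg[OF z] b by (simp add: nonneg_def)
    moreover have "restr (T b) (\<phi> z) \<le> 0"
    proof -
      have "restr (T b) (\<phi> z) \<le> restr (T b) (\<phi> x)" "restr (T b) (\<phi> z) \<le> restr (T b) (\<phi> y)"
        using nn b by (auto simp: nonneg_def restr_minus)
      thus ?thesis using disj[OF b] by (auto simp flip: restr_eq_0_iff)
    qed
    ultimately show ?thesis by simp
  qed
  hence "\<phi> z = 0" using pos_exists_root[OF val_G[OF z]] by (auto simp: restr_eq_0_iff)
  hence "z \<in> Units R" using Units_iff_val z by blast
  hence "\<one> \<in> I" using zI by (metis I.I_l_closed Units_inv_closed Units_l_inv)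
  thus ?thesis by (rule I.one_imp_carrier)
qed

section \<open>Classification of the nonzero prime ideals\<close>

lemma prime_pow: "primeideal P R \<Longrightarrow> x \<in> carrier R \<Longrightarrow> x [^] (n::nat) \<in> P \<Longrightarrow> x \<in> P"
proof (induction n)
  case 0
  then interpret P: primeideal P R by simp
  show ?case using 0 P.one_imp_carrier P.I_notcarr by simp
next
  case (Suc n)
  then interpret P: primeideal P R by simp
  show ?case using Suc P.I_prime[of "x [^] n" "x"] by auto
qed

lemma val_surj_sum:
  assumes "F \<subseteq> V"
  shows "\<exists>z\<in>carrier R - {\<zero>}. \<phi> z = (\<Sum>v\<in>F. single v (of_nat N))"
proof (rule val_surj)
  show "(\<Sum>v\<in>F. single v (of_nat N)) \<in> G" using assms by (intro G_sum single_in_G) auto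
  show "nonneg (\<Sum>v\<in>F. single v (of_nat N))" by (intro nonneg_sum nonneg_single) simp
qed

text \<open>An element of this value is associated to the product of the \<open>N\<close>-th powers
  of the \<open>e v\<close>, and primality selects a factor. The induction splits off one power at a
  time; for empty \<open>F\<close> the prime would contain a unit.\<close>

lemma prime_contains_e:
  assumes P: "primeideal P R" and F: "finite F" "F \<subseteq> V"
    and z: "z \<in> P" "z \<in> carrier R - {\<zero>}" "\<phi> z = (\<Sum>v\<in>F. single v (of_nat N))"
  shows "\<exists>v\<in>F. e v \<in> P"
  using F z
proof (induction F arbitrary: z rule: finite_induct)
  case empty
  interpret P: primeideal P R by (rule P)
  have "z \<in> Units R" using empty Units_iff_val by auto
  hence "\<one> \<in> P" using empty by (metis P.I_l_closed Units_inv_closed Units_l_inv)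
  hence False using P.one_imp_carrier P.I_notcarr by auto
  thus ?case ..
next
  case (insert v F)
  interpret P: primeideal P R by (rule P)
  have vV: "v \<in> V" using insert by auto
  define y where "y = e v [^] N"
  have y: "y \<in> carrier R - {\<zero>}" "\<phi> y = single v (of_nat N)"
  proof -
    show "y \<in> carrier R - {\<zero>}" unfolding y_def using val_pow e_props vV by blast
    have "\<phi> y = (\<Sum>i<N. single v 1)" unfolding y_def using val_pow e_props vV by metis
    thus "\<phi> y = single v (of_nat N)"
      by (intro poly_mapping_eqI) (simp only: lookup_sum_const, simp add: lookup_single when_def)
  qed
  obtain z' where z': "z' \<in> carrier R - {\<zero>}" "\<phi> z' = (\<Sum>v\<in>F. single v (of_nat N))"
    using val_surj_sum[of F N] insert.prems by auto
  have "z divides (y \<otimes> z')"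
    using insert y z' mult_nonzero by (intro val_divides) (auto simp: val_mult)
  hence "y \<otimes> z' \<in> P" using ideal_divides[OF P.is_ideal] insert by blast
  hence "y \<in> P \<or> z' \<in> P" using P.I_prime y z' by blast
  thus ?case
  proof
    assume "y \<in> P"
    hence "e v \<in> P" using prime_pow[OF P, of "e v" N] e_props(1)[OF vV] by (simp add: y_def)
    thus ?thesis by blast
  next
    assume "z' \<in> P"
    thus ?thesis using insert.IH[of z'] insert.prems z' by auto
  qed
qed

text \<open>By \<open>nonneg_bound\<close>, \<open>x\<close> divides an element whose value is a
  constant \<open>N\<close> on the keys of \<open>x\<close>, and \<open>prime_contains_e\<close>
  applies to that element.\<close>

lemma prime_contains_e_key:
  assumes P: "primeideal P R" and x: "x \<in> P" "x \<noteq> \<zero>"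
  shows "\<exists>v\<in>keys (\<phi> x). e v \<in> P"
proof -
  interpret P: primeideal P R by (rule P)
  have x': "x \<in> carrier R - {\<zero>}" using x by auto
  obtain N :: nat where N: "nonneg ((\<Sum>v\<in>keys (\<phi> x). single v (of_nat N)) - \<phi> x)"
    using nonneg_bound val_G x' by blast
  have sub: "keys (\<phi> x) \<subseteq> V" using val_G[OF x'] by (auto simp: G_def)
  obtain z where z: "z \<in> carrier R - {\<zero>}" "\<phi> z = (\<Sum>v\<in>keys (\<phi> x). single v (of_nat N))"
    using val_surj_sum[OF sub] by blast
  have "x divides z" using N z x' by (intro val_divides) auto
  hence "z \<in> P" using ideal_divides[OF P.is_ideal] x by blast
  thus ?thesis using prime_contains_e[OF P _ sub] z by auto
qed

lemma prime_eq_prime_at: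
  assumes P: "primeideal P R" and nz: "P \<noteq> {\<zero>}"
  shows "\<exists>v\<in>V. P = prime_at v"
proof -
  interpret P: primeideal P R by (rule P)
  define S where "S = {v \<in> V. e v \<in> P}"
  have "\<zero> \<in> P" by simp
  then obtain x where x: "x \<in> P" "x \<noteq> \<zero>" using nz by blast
  have keyV: "keys (\<phi> x) \<subseteq> V" if "x \<in> P" "x \<noteq> \<zero>" for x using val_G[of x] that by (auto simp: G_def)
  have "S \<noteq> {}" using prime_contains_e_key[OF P x] keyV[OF x] by (auto simp: S_def)
  \<comment> \<open>The greatest index of \<open>S\<close> is the least dominant one; the next two
    facts amount to \<open>S = T v\<close>.\<close>
  then obtain v where v: "v \<in> S" "\<And>s. s \<in> S \<Longrightarrow> s \<le> v" using V_greatest[of S] by (auto simp: S_def)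
  hence vV: "v \<in> V" and evP: "e v \<in> P" by (auto simp: S_def)
  obtain b where b: "b \<in> B" "v \<in> T b" using T_root[OF vV] by blast
  \<comment> \<open>Indices of \<open>S\<close> on different root chains would give two coprime
    elements of \<open>P\<close>.\<close>
  have ST: "w \<in> T v" if "w \<in> S" for w
  proof -
    have w: "w \<in> V" "e w \<in> P" using that by (auto simp: S_def)
    obtain b' where b': "b' \<in> B" "w \<in> T b'" using T_root[OF w(1)] by blast
    have "b' = b"
    proof (rule ccontr)
      assume ne: "b' \<noteq> b"
      have "keys (\<phi> (e v)) \<inter> T c = {} \<or> keys (\<phi> (e w)) \<inter> T c = {}" if "c \<in> B" for c
      proof (rule ccontr)
        assume "\<not> ?thesis"
        hence "v \<in> T c" "w \<in> T c" using e_props vV w(1) by auto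
        hence "c = b" "c = b'" using T_disjoint b b' that by blast+
        thus False using ne by simp
      qed
      hence "P = carrier R" using evP w vV e_props P.is_ideal by (intro coprime_unit[of _ "e v" "e w"]) auto
      thus False using P.I_notcarr by simp
    qed
    moreover have "T v = {u \<in> T b. u \<le> v}" using T_initial b B_subset by blast
    ultimately show ?thesis using b' v(2)[OF that] by auto
  qed
  \<comment> \<open>A dominating index carries a larger value, so \<open>e v\<close> divides
    \<open>e w\<close>.\<close>
  have TS: "e w \<in> P" if "w \<in> T v" for w
  proof -
    have "w \<in> V" using T_subset vV that by blast
    hence "e v divides e w"
      using nonneg_single_diff[OF vV that, of 1] e_props vV by (intro val_divides) auto
    thus ?thesis using ideal_divides[OF P.is_ideal evP] by blast
  qed
  have "P = prime_at v"
  proof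
    show "P \<subseteq> prime_at v"
    proof
      fix y assume y: "y \<in> P"
      show "y \<in> prime_at v"
      proof (cases "y = \<zero>")
        case False
        then obtain w where "w \<in> keys (\<phi> y)" "e w \<in> P" using prime_contains_e_key[OF P y] by blast
        thus ?thesis using ST[of w] keyV[OF y False] y by (auto simp: S_def prime_at_def)
      qed (simp add: prime_at_def)
    qed
    show "prime_at v \<subseteq> P"
    proof
      fix y assume y: "y \<in> prime_at v"
      show "y \<in> P"
      proof (cases "y = \<zero>")
        case False
        hence y': "y \<in> carrier R - {\<zero>}" "keys (\<phi> y) \<inter> T v \<noteq> {}" using y by (auto simp: prime_at_def)
        \<comment> \<open>Some power of \<open>y\<close> is a multiple of an \<open>e w\<close>
          already known to lie in \<open>P\<close>; primality then gives \<open>y\<close>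
          itself.\<close>
        obtain w N where w: "w \<in> T v" "nonneg ((\<Sum>i<(N::nat). \<phi> y) - single w 1)"
          using nonneg_multiple_diff_single[OF val_nonneg vV] y' by blast
        have "w \<in> V" using w T_subset vV by auto
        hence "e w divides (y [^] N)" using w val_pow[OF y'(1)] e_props by (intro val_divides) auto
        hence "y [^] N \<in> P" using ideal_divides[OF P.is_ideal TS[OF w(1)]] by blast
        thus ?thesis using prime_pow[OF P] y' by blast
      qed simp
    qed
  qed
  thus ?thesis using vV by blast
qed

lemma nonzero_prime_ideals_eq: "nonzero_prime_ideals R = prime_at ` V"
  unfolding nonzero_prime_ideals_def
  using prime_eq_prime_at primeideal_prime_at prime_at_nonzero by auto

section \<open>Maximal ideals\<close>

lemma prime_at_mono: "v \<in> V \<Longrightarrow> w \<in> T v \<Longrightarrow> prime_at w \<subseteq> prime_at v"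
  using T_mono[of v w] by (auto simp: prime_at_def)

text \<open>By \<open>B_maximal\<close> the only root chain through \<open>b\<close> is
  \<open>T b\<close>, so \<open>e b\<close> and an element outside \<open>prime_at b\<close> share
  no root chain; \<open>coprime_unit\<close> then gives the whole ring.\<close>

lemma maximalideal_prime_at:
  assumes b: "b \<in> B" shows "maximalideal (prime_at b) R"
proof -
  have bV: "b \<in> V" using b B_subset by auto
  interpret P: primeideal "prime_at b" R by (rule primeideal_prime_at[OF bV])
  show ?thesis
  proof (rule maximalidealI)
    show "carrier R \<noteq> prime_at b" by (rule P.I_notcarr)
    fix J assume J: "ideal J R" "prime_at b \<subseteq> J" "J \<subseteq> carrier R"
    show "J = prime_at b \<or> J = carrier R"
    proof (rule disjCI)
      assume ne: "J \<noteq> carrier R"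
      show "J = prime_at b"
      proof (rule ccontr)
        assume "J \<noteq> prime_at b"
        then obtain y where y: "y \<in> J" "y \<notin> prime_at b" using J by blast
        have "y \<in> carrier R" using y J by blast
        hence y': "y \<in> carrier R - {\<zero>}" "keys (\<phi> y) \<inter> T b = {}"
          using not_mem_prime_atD[OF _ y(2)] by blast+
        have "keys (\<phi> (e b)) \<inter> T c = {} \<or> keys (\<phi> y) \<inter> T c = {}" if "c \<in> B" for c
          using y' e_props[OF bV] B_maximal[OF b, of c] that B_subset by auto
        moreover have "e b \<in> J" using J e_mem_prime_at[OF bV bV] T_refl[OF bV] by blast
        ultimately have "J = carrier R"
          using J y y' e_props[OF bV] by (intro coprime_unit[of _ "e b" y]) auto
        thus False using ne by simp
      qed
    qed
  qed (rule P.is_ideal)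
qed

lemma maximal_ideals_eq:
  assumes "V \<noteq> {}" shows "maximal_ideals R = prime_at ` B"
proof
  show "prime_at ` B \<subseteq> maximal_ideals R"
    using maximalideal_prime_at by (auto simp: maximal_ideals_def)
  show "maximal_ideals R \<subseteq> prime_at ` B"
  proof
    fix M assume "M \<in> maximal_ideals R"
    hence M: "maximalideal M R" by (simp add: maximal_ideals_def)
    interpret M: maximalideal M R by (rule M)
    have P: "primeideal M R" by (rule maximalideal_prime[OF M])
    have below: "M = prime_at v" if "v \<in> V" "M \<subseteq> prime_at v" for v
    proof -
      interpret Pv: primeideal "prime_at v" R using primeideal_prime_at that by blast
      show ?thesis using M.I_maximal[OF Pv.is_ideal that(2)] Pv.I_notcarr Pv.a_subset by auto
    qed
    obtain u where u: "u \<in> V" "M = prime_at u"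
    \<comment> \<open>A zero \<open>M\<close> would lie inside the proper ideal
      \<open>prime_at u\<close> of any \<open>u\<close>, so maximality yields the required form in
      this case too.\<close>
    proof (cases "M = {\<zero>}")
      case True
      obtain u where u: "u \<in> V" using assms by blast
      have "M \<subseteq> prime_at u" using True by (simp add: prime_at_def)
      thus ?thesis using below[OF u] u that by blast
    next
      case False
      thus ?thesis using prime_eq_prime_at[OF P] that by blast
    qed
    obtain b where b: "b \<in> B" "u \<in> T b" using T_root[OF u(1)] by blast
    hence "M = prime_at b" using below[of b] prime_at_mono[of b u] u B_subset by blast
    thus "M \<in> prime_at ` B" using b by blast
  qed
qed

section \<open>Irreducible elements and atoms\<close>

lemma irreducible_iff_val:
  assumes x: "x \<in> carrier R"
  shows "ring_irreducible x \<longleftrightarrow> x \<noteq> \<zero> \<and> (\<exists>a\<in>A. \<phi> x = single a 1)"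
proof
  assume irr: "ring_irreducible x"
  hence x': "x \<in> carrier R - {\<zero>}" and xu: "x \<notin> Units R"
    and fac: "\<And>y z. y \<in> carrier R \<Longrightarrow> z \<in> carrier R \<Longrightarrow> x = y \<otimes> z \<Longrightarrow> y \<in> Units R \<or> z \<in> Units R"
    using ring_irreducible_iff[OF x] x by auto
  \<comment> \<open>Every nonnegative value is attained and comparison of values is divisibility, so
    a decomposition of \<open>\<phi> x\<close> into nonnegative parts gives a factorization of
    \<open>x\<close>.\<close>
  have split: "g = 0 \<or> \<phi> x = g" if g: "g \<in> G" "nonneg g" "nonneg (\<phi> x - g)" for g
  proof -
    obtain y where y: "y \<in> carrier R - {\<zero>}" "\<phi> y = g" using val_surj g by blast
    have "y divides x" using val_divides y x' g by blast
    then obtain z where z: "z \<in> carrier R" "x = y \<otimes> z" by (auto simp: factor_def)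
    hence z': "z \<in> carrier R - {\<zero>}" using x' y by auto
    hence "\<phi> x = g + \<phi> z" using z y val_mult by simp
    thus ?thesis using fac[of y z] z z' y Units_iff_val[of y] Units_iff_val[of z] by auto
  qed
  obtain b where b: "b \<in> B" "keys (\<phi> x) \<inter> T b \<noteq> {}"
    using pos_exists_root[OF val_G[OF x']] xu Units_iff_val[OF x'] by auto
  have bV: "b \<in> V" using b B_subset by auto
  obtain c where c: "c > 0" "nonneg (\<phi> x - single b c)" "b \<in> A \<longrightarrow> c = 1"
    using root_single_le[OF val_nonneg[OF x'] val_G[OF x'] b] by blast
  have "single b c \<in> G" using bV c(3) by (intro single_in_G) auto
  moreover have c0: "single b d \<noteq> 0" if "d > 0" for d :: rat
    using that by (metis lookup_single_eq lookup_zero less_irrefl)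
  ultimately have eq: "\<phi> x = single b c" using split[of "single b c"] c nonneg_single by auto
  \<comment> \<open>Outside \<open>A\<close> the group contains halves, and half of the value would
    belong to a proper divisor.\<close>
  have "b \<in> A"
  proof (rule ccontr)
    assume "b \<notin> A"
    hence "single b (c / 2) \<in> G" using bV by (intro single_in_G) auto
    moreover have "\<phi> x - single b (c / 2) = single b (c / 2)"
      unfolding eq by (simp flip: single_diff)
    ultimately have "single b c = single b (c / 2)"
      using split[of "single b (c / 2)"] c nonneg_single c0[of "c / 2"] eq by auto
    hence "c = c / 2" by (metis lookup_single_eq)
    thus False using c by simp
  qed
  thus "x \<noteq> \<zero> \<and> (\<exists>a\<in>A. \<phi> x = single a 1)" using eq c x' by auto
next
  assume "x \<noteq> \<zero> \<and> (\<exists>a\<in>A. \<phi> x = single a 1)"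
  then obtain a where x': "x \<in> carrier R - {\<zero>}" and a: "a \<in> A" "\<phi> x = single a 1" using x by auto
  have "y \<in> Units R \<or> z \<in> Units R" if yz: "y \<in> carrier R" "z \<in> carrier R" "x = y \<otimes> z" for y z
  proof -
    have y: "y \<in> carrier R - {\<zero>}" and z: "z \<in> carrier R - {\<zero>}" using yz x' by auto
    have eq: "single a 1 = \<phi> y + \<phi> z" using val_mult[OF y z] yz a by simp
    hence "nonneg (single a 1 - \<phi> y)" using val_nonneg[OF z] by simp
    hence "\<phi> y = 0 \<or> \<phi> y = single a 1"
      using single_root_minimal[OF val_G[OF y] val_nonneg[OF y] a(1)] by blast
    thus ?thesis using eq Units_iff_val[OF y] Units_iff_val[OF z] by auto
  qed
  moreover have "x \<notin> Units R"
    using a Units_iff_val[OF x'] by (metis lookup_single_eq lookup_zero one_neq_zero)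
  ultimately show "ring_irreducible x" using ring_irreducible_iff[OF x] x' by auto
qed

lemma A_e_divides:
  assumes "a \<in> A" "x \<in> carrier R - {\<zero>}" shows "e a divides x \<longleftrightarrow> x \<in> prime_at a"
proof -
  have aB: "a \<in> B" and aV: "a \<in> V" using assms A_subset B_subset by auto
  show ?thesis
  proof
    assume "e a divides x"
    thus "x \<in> prime_at a"
      using ideal_divides[OF ideal_prime_at[OF aV]] e_mem_prime_at[OF aV aV] T_refl[OF aV] by blast
  next
    assume "x \<in> prime_at a"
    hence "nonneg (\<phi> x - single a 1)"
      using root_single_le[OF val_nonneg val_G aB] assms by (auto simp: prime_at_def)
    thus "e a divides x" using e_props[OF aV] assms by (intro val_divides) auto
  qed
qed

lemma PIdl_irreducible:
  assumes "x \<in> carrier R - {\<zero>}" "a \<in> A" "\<phi> x = single a 1"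
  shows "PIdl x = prime_at a"
proof -
  have aV: "a \<in> V" using assms A_subset B_subset by auto
  have "x divides y \<longleftrightarrow> y \<in> prime_at a" if "y \<in> carrier R" for y
  proof (cases "y = \<zero>")
    case True
    thus ?thesis using assms by (auto simp: prime_at_def factor_def intro!: bexI[of _ \<zero>])
  next
    case False
    hence y: "y \<in> carrier R - {\<zero>}" using that by simp
    have "x divides y \<longleftrightarrow> e a divides y"
      using divides_iff_val[OF assms(1) y] divides_iff_val[OF _ y, of "e a"] e_props[OF aV] assms by auto
    thus ?thesis using A_e_divides[OF assms(2) y] by simp
  qed
  moreover have "PIdl x = {y \<in> carrier R. x divides y}"
    using assms by (auto simp: cgenideal_def factor_def m_comm)
  ultimately show ?thesis by (auto simp: prime_at_def)
qed

lemma atoms_eq: "atoms R = prime_at ` A"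
proof
  show "atoms R \<subseteq> prime_at ` A"
  proof
    fix I assume "I \<in> atoms R"
    then obtain x where x: "x \<in> carrier R" "ring_irreducible x" "I = PIdl x"
      by (auto simp: atoms_def)
    then obtain a where "a \<in> A" "\<phi> x = single a 1" "x \<noteq> \<zero>" using irreducible_iff_val by blast
    thus "I \<in> prime_at ` A" using PIdl_irreducible[of x a] x by blast
  qed
  show "prime_at ` A \<subseteq> atoms R"
  proof
    fix I assume "I \<in> prime_at ` A"
    then obtain a where a: "a \<in> A" "I = prime_at a" by blast
    have aV: "a \<in> V" using a A_subset B_subset by auto
    show "I \<in> atoms R" unfolding atoms_def
      using PIdl_irreducible[of "e a" a] irreducible_iff_val[of "e a"] e_props[OF aV] a
      by (intro CollectI exI[of _ "e a"]) auto
  qed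
qed

text \<open>Induction on the generators, joining one at a time through \<open>val_bezout\<close>,
  produces a common divisor inside the ideal, which therefore generates it. Zero generators are
  treated apart because values are only controlled off zero.\<close>

lemma bezout: "bezout_domain R"
  unfolding bezout_domain_def
proof (intro conjI allI impI)
  show "domain R" by (rule domain_axioms)
  fix S assume S: "finite S \<and> S \<subseteq> carrier R"
  hence "finite S" "S \<subseteq> carrier R" by auto
  hence "\<exists>d\<in>Idl S. \<forall>s\<in>S. d divides s"
  proof (induction S rule: finite_induct)
    case empty
    have "\<zero> \<in> Idl {}" using genideal_ideal[of "{}"] additive_subgroup.zero_closed ideal.axioms(1) by blast
    thus ?case by blast
  next
    case (insert x S)
    have I: "ideal (Idl (insert x S)) R" using insert by (intro genideal_ideal) auto
    then interpret I: ideal "Idl (insert x S)" R .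
    have sub: "insert x S \<subseteq> Idl (insert x S)" using insert by (intro genideal_self) auto
    hence sub': "Idl S \<subseteq> Idl (insert x S)" using I by (intro genideal_minimal) auto
    obtain d where d: "d \<in> Idl S" "\<forall>s\<in>S. d divides s" using insert by auto
    have dI: "d \<in> Idl (insert x S)" using d sub' by auto
    hence dc: "d \<in> carrier R" by (rule I.Icarr)
    have xc: "x \<in> carrier R" using insert by simp
    have dvd0: "y divides \<zero>" if "y \<in> carrier R" for y
      using that by (auto simp: factor_def intro!: bexI[of _ \<zero>])
    consider "x = \<zero>" | "d = \<zero>" "x \<noteq> \<zero>" | "x \<in> carrier R - {\<zero>}" "d \<in> carrier R - {\<zero>}"
      using xc dc by auto
    thus ?case
    proof cases
      case 1
      thus ?thesis using d dI dvd0[OF dc] by auto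
    next
      case 2
      hence "x divides s" if "s \<in> S" for s
        using d that divides_trans[OF dvd0[OF xc], of s] xc insert by auto
      thus ?thesis using sub xc by (intro bexI[of _ x]) (auto simp: divides_refl)
    next
      case 3
      then obtain c c' where c: "c \<in> carrier R" "c' \<in> carrier R"
        "(c \<otimes> x \<oplus> c' \<otimes> d) divides x" "(c \<otimes> x \<oplus> c' \<otimes> d) divides d" using val_bezout by blast
      have "c \<otimes> x \<oplus> c' \<otimes> d \<in> Idl (insert x S)"
        using c dI sub by (simp add: I.I_l_closed)
      moreover have "(c \<otimes> x \<oplus> c' \<otimes> d) divides s" if "s \<in> S" for s
        using divides_trans[OF c(4), of s] d that c xc dc insert by auto
      ultimately show ?thesis using c by (intro bexI[of _ "c \<otimes> x \<oplus> c' \<otimes> d"]) auto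
    qed
  qed
  then obtain d where d: "d \<in> Idl S" "\<forall>s\<in>S. d divides s" by blast
  have I: "ideal (Idl S) R" using S by (intro genideal_ideal) auto
  have dc: "d \<in> carrier R" by (rule ideal.Icarr[OF I d(1)])
  have "S \<subseteq> PIdl d" using d(2) dc by (auto simp: cgenideal_def factor_def m_comm)
  hence "Idl S = PIdl d"
    using genideal_minimal[OF cgenideal_ideal[OF dc]] cgenideal_minimal[OF I d(1)] by blast
  thus "principalideal (Idl S) R" using cgenideal_is_principalideal[OF dc] by simp
qed

text \<open>An irreducible divisor of \<open>e b\<close> has value \<open>single a 1\<close> with
  \<open>a\<close> in \<open>A\<close>, which puts \<open>b\<close> into \<open>T a\<close> and
  forces \<open>b = a\<close>. Conversely, a nonzero nonunit has a key in some \<open>T b\<close>,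
  and for \<open>b\<close> in \<open>A\<close> it is divisible by the irreducible
  \<open>e b\<close>.\<close>

lemma furstenberg_iff: "furstenberg_domain R \<longleftrightarrow> A = B"
proof
  assume F: "furstenberg_domain R"
  have "b \<in> A" if b: "b \<in> B" for b
  proof -
    have bV: "b \<in> V" using b B_subset by auto
    have "e b \<notin> Units R"
      using Units_iff_val e_props[OF bV] by (metis lookup_single_eq lookup_zero one_neq_zero)
    then obtain x where x: "x \<in> carrier R" "ring_irreducible x" "x divides e b"
      using F e_props[OF bV] by (auto simp: furstenberg_domain_def)
    then obtain a where a: "a \<in> A" "\<phi> x = single a 1" "x \<in> carrier R - {\<zero>}"
      using irreducible_iff_val by auto
    have aV: "a \<in> V" using a A_subset B_subset by auto
    have "x \<in> prime_at a" using a T_refl[OF aV] by (auto simp: prime_at_def)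
    hence "e b \<in> prime_at a"
      using ideal_divides[OF ideal_prime_at[OF aV]] x by blast
    hence "b \<in> T a" using e_mem_prime_at bV aV by blast
    thus ?thesis using B_maximal[OF b aV] a by simp
  qed
  thus "A = B" using A_subset by auto
next
  assume AB: "A = B"
  show "furstenberg_domain R" unfolding furstenberg_domain_def
  proof (intro conjI ballI impI)
    show "domain R" by (rule domain_axioms)
    fix x assume "x \<in> carrier R" "x \<noteq> \<zero> \<and> x \<notin> Units R"
    hence x: "x \<in> carrier R - {\<zero>}" "x \<notin> Units R" by auto
    then obtain b where b: "b \<in> B" "keys (\<phi> x) \<inter> T b \<noteq> {}"
      using pos_exists_root[OF val_G] Units_iff_val by blast
    hence "e b divides x" using A_e_divides[of b x] AB x by (auto simp: prime_at_def)
    moreover have "ring_irreducible (e b)" "e b \<in> carrier R"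
      using irreducible_iff_val e_props[of b] b AB B_subset by auto
    ultimately show "\<exists>y\<in>carrier R. ring_irreducible y \<and> y divides x" by blast
  qed
qed

text \<open>Products of irreducibles have values supported on \<open>A\<close>, so
  \<open>e v\<close> is no such product for \<open>v\<close> outside \<open>A\<close>. If
  \<open>A = V\<close>, values are vectors of natural numbers, and their coordinate sum counts the
  irreducible factors to be split off.\<close>

lemma atomic_iff: "atomic_domain R \<longleftrightarrow> A = V"
proof
  assume at: "atomic_domain R"
  have "v \<in> A" if v: "v \<in> V" for v
  proof -
    have "e v \<notin> Units R"
      using Units_iff_val e_props[OF v] by (metis lookup_single_eq lookup_zero one_neq_zero)
    then obtain xs where xs: "set xs \<subseteq> carrier R" "\<forall>x\<in>set xs. ring_irreducible x"
      "e v = foldr (\<otimes>) xs \<one>"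
      using at e_props[OF v] by (auto simp: atomic_domain_def)
    have "v \<notin> A \<Longrightarrow> foldr (\<otimes>) xs \<one> \<in> carrier R - {\<zero>} \<and> lookup (\<phi> (foldr (\<otimes>) xs \<one>)) v = 0"
      using xs(1,2)
    proof (induction xs)
      case (Cons x xs)
      then obtain a where a: "a \<in> A" "\<phi> x = single a 1" "x \<in> carrier R - {\<zero>}"
        using irreducible_iff_val by auto
      have "a \<noteq> v" using a Cons by auto
      thus ?case using Cons a val_mult[OF a(3)] mult_nonzero[OF a(3)]
        by (simp add: lookup_add lookup_single when_def)
    qed simp
    thus ?thesis using xs(3) e_props[OF v] by auto
  qed
  thus "A = V" using A_subset B_subset by auto
next
  assume AV: "A = V"
  hence AB: "A = B" using A_subset B_subset by auto
  show "atomic_domain R" unfolding atomic_domain_def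
  proof (intro conjI ballI impI)
    show "domain R" by (rule domain_axioms)
    fix x assume x: "x \<in> carrier R" "x \<noteq> \<zero> \<and> x \<notin> Units R"
    \<comment> \<open>Every index is now a root, and \<open>B_maximal\<close> leaves no proper
      domination.\<close>
    have T_eq: "T v = {v}" if "v \<in> V" for v
      using B_maximal[of _ v] that T_refl T_subset[OF that] AV AB by blast
    define sz where "sz g = (\<Sum>v\<in>keys g. lookup g v)" for g :: "'v \<Rightarrow>\<^sub>0 rat"
    have sz_add: "sz (g + h) = sz g + sz h" for g h
      unfolding sz_def by (rule setsum_keys_plus_distrib[where f = "\<lambda>_ c. c"]) auto
    have sz_nat: "\<exists>n::nat. sz (\<phi> y) = of_nat n" if y: "y \<in> carrier R - {\<zero>}" for y
    proof -
      have "lookup (\<phi> y) v \<in> \<nat>" if "v \<in> keys (\<phi> y)" for v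
      proof -
        have v: "v \<in> V" using that val_G[OF y] by (auto simp: G_def)
        have "0 \<le> restr {v} (\<phi> y)" using nonneg_restr[OF val_nonneg[OF y] v] T_eq[OF v] by simp
        moreover have "restr {v} (\<phi> y) = single v (lookup (\<phi> y) v)"
          by (intro poly_mapping_eqI) (auto simp: lookup_restr lookup_single when_def)
        ultimately have "0 \<le> lookup (\<phi> y) v" by simp
        moreover have "\<forall>a\<in>A. lookup (\<phi> y) a \<in> \<int>" using val_G[OF y] by (simp add: G_def)
        hence "lookup (\<phi> y) v \<in> \<int>" using v AV by blast
        ultimately show ?thesis by (simp add: Nats_altdef2)
      qed
      moreover have "sum f F \<in> \<nat>" if "\<And>v. v \<in> F \<Longrightarrow> f v \<in> \<nat>" for f :: "'v \<Rightarrow> rat" and F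
        using that by (induction F rule: infinite_finite_induct) auto
      ultimately have "sz (\<phi> y) \<in> \<nat>" unfolding sz_def by blast
      thus ?thesis by (auto elim: Nats_cases)
    qed
    have "\<exists>xs. set xs \<subseteq> carrier R \<and> (\<forall>x\<in>set xs. ring_irreducible x) \<and> y = foldr (\<otimes>) xs \<one>"
      if "y \<in> carrier R - {\<zero>}" "y \<notin> Units R" "sz (\<phi> y) = of_nat n" for y and n :: nat
      using that
    proof (induction n arbitrary: y rule: less_induct)
      case (less n)
      obtain b where b: "b \<in> B" "keys (\<phi> y) \<inter> T b \<noteq> {}"
        using less.prems pos_exists_root[OF val_G] Units_iff_val by blast
      have bA: "b \<in> A" and bV: "b \<in> V" using b AB AV by auto
      have "e b divides y" using A_e_divides[OF bA] b less.prems by (auto simp: prime_at_def)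
      then obtain z where z: "z \<in> carrier R" "y = e b \<otimes> z" by (auto simp: factor_def)
      hence z': "z \<in> carrier R - {\<zero>}" using less.prems e_props[OF bV] by auto
      have val: "\<phi> y = single b 1 + \<phi> z" using val_mult z z' e_props[OF bV] by simp
      show ?case
      proof (cases "z \<in> Units R")
        case True
        hence "ring_irreducible y"
          using irreducible_iff_val less.prems val bA Units_iff_val[OF z'] by auto
        thus ?thesis using less.prems by (intro exI[of _ "[y]"]) auto
      next
        case False
        obtain m :: nat where m: "sz (\<phi> z) = of_nat m" using sz_nat[OF z'] by blast
        have "sz (single b 1) = 1" by (simp add: sz_def)
        hence "of_nat n = (of_nat (Suc m) :: rat)" using less.prems(3) m val sz_add by simp
        hence "m < n" by (simp del: of_nat_Suc)
        then obtain xs where xs: "set xs \<subseteq> carrier R" "\<forall>x\<in>set xs. ring_irreducible x" "z = foldr (\<otimes>) xs \<one>"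
          using less.IH[OF _ z' False m] by blast
        moreover have "ring_irreducible (e b)" using irreducible_iff_val e_props[OF bV] bA by auto
        ultimately show ?thesis using z e_props[OF bV] by (intro exI[of _ "e b # xs"]) auto
      qed
    qed
    thus "\<exists>xs. set xs \<subseteq> carrier R \<and> (\<forall>x\<in>set xs. ring_irreducible x) \<and> x = foldr (\<otimes>) xs \<one>"
      using x sz_nat[of x] by auto
  qed
qed

text \<open>A nonzero element of the Jacobson radical has a key in every root chain. Keys are finite
  in number and these chains are disjoint, so infinite \<open>B\<close> excludes it; for finite
  \<open>B\<close> the sum of the unit vectors over \<open>B\<close> is the value of such an
  element.\<close>

lemma semiprimitive_iff:
  assumes "V \<noteq> {}" shows "semiprimitive R \<longleftrightarrow> infinite B"
proof
  assume sp: "semiprimitive R"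
  show "infinite B"
  proof
    assume fin: "finite B"
    obtain x where x: "x \<in> carrier R - {\<zero>}" "\<phi> x = (\<Sum>b\<in>B. single b 1)"
      using val_surj_sum[OF B_subset, of 1] by auto
    have "x \<in> prime_at b" if "b \<in> B" for b
    proof -
      have "lookup (\<phi> x) b = 1" using that fin x by (simp add: lookup_sum lookup_single when_def)
      hence "b \<in> keys (\<phi> x)" by (simp add: in_keys_iff)
      thus ?thesis using that x T_refl B_subset by (auto simp: prime_at_def)
    qed
    hence "x \<in> jacobson_radical R" using x maximal_ideals_eq[OF assms] by (auto simp: jacobson_radical_def)
    thus False using sp x by (auto simp: semiprimitive_def)
  qed
next
  assume inf: "infinite B"
  have "x = \<zero>" if "x \<in> jacobson_radical R" for x
  proof (rule ccontr)
    assume "x \<noteq> \<zero>"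
    hence k: "keys (\<phi> x) \<inter> T b \<noteq> {}" if "b \<in> B" for b
      using \<open>x \<in> jacobson_radical R\<close> maximal_ideals_eq[OF assms] that
      by (auto simp: jacobson_radical_def prime_at_def)
    define f where "f b = (SOME k. k \<in> keys (\<phi> x) \<inter> T b)" for b
    have f: "f b \<in> keys (\<phi> x) \<inter> T b" if "b \<in> B" for b
      unfolding f_def by (rule someI_ex) (use k[OF that] in blast)
    have "inj_on f B"
    proof (rule inj_onI)
      fix b b' assume b: "b \<in> B" "b' \<in> B" "f b = f b'"
      have "f b \<in> T b" using f[OF b(1)] by (rule IntD2)
      moreover have "f b \<in> T b'" unfolding b(3) using f[OF b(2)] by (rule IntD2)
      ultimately show "b = b'" using T_disjoint[OF b(1,2)] by blast
    qed
    moreover have "f ` B \<subseteq> keys (\<phi> x)" using f by auto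
    ultimately show False using inf by (meson finite_imageD finite_keys finite_subset)
  qed
  moreover have "\<zero> \<in> jacobson_radical R"
    using maximal_ideals_eq[OF assms] by (auto simp: jacobson_radical_def prime_at_def)
  ultimately show "semiprimitive R" unfolding semiprimitive_def by blast
qed

end

section \<open>The ring of elements of nonnegative content\<close>

context root_forest
begin

text \<open>The group ring of \<open>G\<close> is carved out of the group ring of all finitely
  supported functions, so that fractions live in a type independent of \<open>A\<close>,
  \<open>B\<close> and \<open>V\<close>.\<close>

definition Pol :: "(('v \<Rightarrow>\<^sub>0 rat) \<Rightarrow>\<^sub>0 int) set" where
  "Pol = {p. keys p \<subseteq> G}"

text \<open>The Gauss valuation belonging to one chain; over all roots these minima are the
  components of the meet of the exponents.\<close>

definition minval :: "'v \<Rightarrow> (('v \<Rightarrow>\<^sub>0 rat) \<Rightarrow>\<^sub>0 int) \<Rightarrow> 'v \<Rightarrow>\<^sub>0 rat" where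
  "minval b p = Min (restr (T b) ` keys p)"

lemma Pol_one: "1 \<in> Pol"
  by (simp add: Pol_def)

lemma Pol_single: "g \<in> G \<Longrightarrow> single g c \<in> Pol"
  by (simp add: Pol_def)

lemma Pol_add: "p \<in> Pol \<Longrightarrow> q \<in> Pol \<Longrightarrow> p + q \<in> Pol"
  using keys_add[of p q] by (auto simp: Pol_def)

lemma Pol_uminus: "p \<in> Pol \<Longrightarrow> - p \<in> Pol"
  by (simp add: Pol_def)

lemma Pol_mult: "p \<in> Pol \<Longrightarrow> q \<in> Pol \<Longrightarrow> p * q \<in> Pol"
  using keys_mult[of p q] by (force simp: Pol_def intro: G_add)

lemma minval_mult: "p \<noteq> 0 \<Longrightarrow> q \<noteq> 0 \<Longrightarrow> minval b (p * q) = minval b p + minval b q"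
  unfolding minval_def by (rule Min_keys_mult) (auto simp: restr_add)

lemma minval_add:
  "p \<noteq> 0 \<Longrightarrow> q \<noteq> 0 \<Longrightarrow> p + q \<noteq> 0 \<Longrightarrow> min (minval b p) (minval b q) \<le> minval b (p + q)"
  unfolding minval_def by (rule Min_keys_add)

lemma minval_one [simp]: "minval b 1 = 0"
  by (simp add: minval_def)

lemma minval_uminus [simp]: "minval b (- p) = minval b p"
  by (simp add: minval_def)

text \<open>The root chains partition \<open>V\<close>, so the minima can be glued along them. The
  result has finite support and is integral on \<open>A\<close> because each minimum is the
  restriction of one of the finitely many exponents of \<open>p\<close>.\<close>

lemma content_exists:
  assumes p: "p \<in> Pol" "p \<noteq> 0" shows "\<exists>g\<in>G. \<forall>b\<in>B. restr (T b) g = minval b p"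
proof -
  define root where "root w = (SOME b. b \<in> B \<and> w \<in> T b)" for w
  have root: "root w = b" if "b \<in> B" "w \<in> T b" for b w
  proof -
    have "root w \<in> B \<and> w \<in> T (root w)" unfolding root_def by (rule someI_ex) (use that in blast)
    thus ?thesis using T_disjoint[of "root w" b] that by blast
  qed
  have val_in: "\<exists>k\<in>keys p. minval b p = restr (T b) k" for b
  proof -
    have "minval b p \<in> restr (T b) ` keys p" unfolding minval_def using p by (intro Min_in) auto
    thus ?thesis by blast
  qed
  define F where "F w = (if w \<in> V then lookup (minval (root w) p) w else 0)" for w
  have "{w. F w \<noteq> 0} \<subseteq> \<Union> (keys ` keys p)"
  proof
    fix w assume "w \<in> {w. F w \<noteq> 0}"
    hence "lookup (minval (root w) p) w \<noteq> 0" by (auto simp: F_def split: if_splits)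
    then obtain k where "k \<in> keys p" "lookup (restr (T (root w)) k) w \<noteq> 0"
      using val_in[of "root w"] by auto
    thus "w \<in> \<Union> (keys ` keys p)" by (auto simp: lookup_restr in_keys_iff split: if_splits)
  qed
  hence "finite {w. F w \<noteq> 0}" by (rule finite_subset) auto
  hence L: "lookup (Abs_poly_mapping F) = F" by (rule lookup_Abs_poly_mapping)
  have "Abs_poly_mapping F \<in> G" unfolding G_def
  proof (intro CollectI conjI ballI)
    show "keys (Abs_poly_mapping F) \<subseteq> V" by (auto simp: in_keys_iff L F_def split: if_splits)
    fix a assume a: "a \<in> A"
    hence "a \<in> B" "a \<in> V" using A_subset B_subset by auto
    hence r: "root a = a" using root T_refl by blast
    obtain k where k: "k \<in> keys p" "minval a p = restr (T a) k" using val_in by blast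
    have "k \<in> G" using k p by (auto simp: Pol_def)
    hence "lookup k a \<in> \<int>" using a by (simp add: G_def)
    thus "lookup (Abs_poly_mapping F) a \<in> \<int>"
      unfolding L F_def r k(2) by (simp add: lookup_restr)
  qed
  moreover have "restr (T b) (Abs_poly_mapping F) = minval b p" if b: "b \<in> B" for b
  proof (rule poly_mapping_eqI)
    fix w
    obtain k where k: "minval b p = restr (T b) k" using val_in by blast
    show "lookup (restr (T b) (Abs_poly_mapping F)) w = lookup (minval b p) w"
    proof (cases "w \<in> T b")
      case True
      hence "w \<in> V" using T_subset b B_subset by blast
      thus ?thesis using True root[OF b True] by (simp add: lookup_restr L F_def)
    qed (simp add: lookup_restr k)
  qed
  ultimately show ?thesis by blast
qed

text \<open>A relation, because a fraction has many representations and only those by elements of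
  \<open>Pol\<close> count; \<open>content_unique\<close> shows it to be single-valued. Zero has no
  content.\<close>

definition content :: "(('v \<Rightarrow>\<^sub>0 rat) \<Rightarrow>\<^sub>0 int) fract \<Rightarrow> ('v \<Rightarrow>\<^sub>0 rat) \<Rightarrow> bool" where
  "content x g \<longleftrightarrow> g \<in> G \<and> (\<exists>p q. p \<in> Pol \<and> q \<in> Pol \<and> p \<noteq> 0 \<and> q \<noteq> 0 \<and> x = Fract p q \<and>
     (\<forall>b\<in>B. restr (T b) g = minval b p - minval b q))"

lemma contentE:
  assumes "content x g"
  obtains p q where "g \<in> G" "p \<in> Pol" "q \<in> Pol" "p \<noteq> 0" "q \<noteq> 0" "x = Fract p q"
    "\<And>b. b \<in> B \<Longrightarrow> restr (T b) g = minval b p - minval b q"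
  using assms unfolding content_def by blast

lemma contentI:
  assumes "g \<in> G" "p \<in> Pol" "q \<in> Pol" "p \<noteq> 0" "q \<noteq> 0" "x = Fract p q"
    "\<And>b. b \<in> B \<Longrightarrow> restr (T b) g = minval b p - minval b q"
  shows "content x g"
  using assms unfolding content_def by blast

lemma content_Fract_exists:
  assumes "p \<in> Pol" "q \<in> Pol" "p \<noteq> 0" "q \<noteq> 0"
  shows "\<exists>g. content (Fract p q) g \<and> (\<forall>b\<in>B. restr (T b) g = minval b p - minval b q)"
proof -
  obtain g h where "g \<in> G" "\<forall>b\<in>B. restr (T b) g = minval b p" "h \<in> G" "\<forall>b\<in>B. restr (T b) h = minval b q"
    using content_exists assms by meson
  hence "content (Fract p q) (g - h)" "\<forall>b\<in>B. restr (T b) (g - h) = minval b p - minval b q"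
    using assms by (auto intro!: contentI[of _ p q] G_minus simp: restr_minus)
  thus ?thesis by blast
qed

lemma content_nonzero: assumes "content x g" shows "x \<noteq> 0"
proof -
  obtain p q where "p \<noteq> 0" "q \<noteq> 0" "x = Fract p q" using assms by (rule contentE)
  thus ?thesis by (simp add: Zero_fract_def eq_fract)
qed

text \<open>Cross-multiplying two representations and using multiplicativity of
  \<open>minval\<close> equates the values on each root chain.\<close>

lemma content_unique:
  assumes "content x g" "content x h" shows "g = h"
proof -
  obtain p q where p: "g \<in> G" "p \<in> Pol" "q \<in> Pol" "p \<noteq> 0" "q \<noteq> 0" "x = Fract p q"
    "\<And>b. b \<in> B \<Longrightarrow> restr (T b) g = minval b p - minval b q" using assms(1) by (rule contentE) blast
  obtain p' q' where p': "h \<in> G" "p' \<in> Pol" "q' \<in> Pol" "p' \<noteq> 0" "q' \<noteq> 0" "x = Fract p' q'"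
    "\<And>b. b \<in> B \<Longrightarrow> restr (T b) h = minval b p' - minval b q'" using assms(2) by (rule contentE) blast
  have "p * q' = p' * q" using p p' by (simp add: eq_fract)
  hence "minval b (p * q') = minval b (p' * q)" for b by simp
  hence v: "minval b p + minval b q' = minval b p' + minval b q" for b using p p' by (simp add: minval_mult)
  have "restr (T b) (g - h) = 0" if "b \<in> B" for b
    unfolding restr_minus p(7)[OF that] p'(7)[OF that] using v[of b] by (simp add: algebra_simps)
  moreover have "restr (T b) (- (g - h)) = restr (T b) 0 - restr (T b) (g - h)" for b
    using restr_minus[of "T b" 0 "g - h"] by simp
  ultimately have "nonneg (g - h)" "nonneg (- (g - h))" unfolding nonneg_def by simp_all
  hence "g - h = 0" using G_minus p(1) p'(1) by (intro G_antisym)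
  thus ?thesis by simp
qed

lemma content_mult:
  assumes "content x g" "content y h" shows "content (x * y) (g + h)"
proof -
  obtain p q where p: "g \<in> G" "p \<in> Pol" "q \<in> Pol" "p \<noteq> 0" "q \<noteq> 0" "x = Fract p q"
    "\<And>b. b \<in> B \<Longrightarrow> restr (T b) g = minval b p - minval b q" using assms(1) by (rule contentE) blast
  obtain p' q' where p': "h \<in> G" "p' \<in> Pol" "q' \<in> Pol" "p' \<noteq> 0" "q' \<noteq> 0" "y = Fract p' q'"
    "\<And>b. b \<in> B \<Longrightarrow> restr (T b) h = minval b p' - minval b q'" using assms(2) by (rule contentE) blast
  show ?thesis
    using p p' by (intro contentI[of _ "p * p'" "q * q'"]) (simp_all add: Pol_mult G_add restr_add minval_mult)
qed

lemma content_inverse: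
  assumes "content x g" shows "content (inverse x) (- g)"
proof -
  obtain p q where p: "g \<in> G" "p \<in> Pol" "q \<in> Pol" "p \<noteq> 0" "q \<noteq> 0" "x = Fract p q"
    "\<And>b. b \<in> B \<Longrightarrow> restr (T b) g = minval b p - minval b q" using assms(1) by (rule contentE) blast
  have "- g \<in> G" using G_minus[OF G_zero p(1)] by simp
  moreover have "restr (T b) (- g) = - restr (T b) g" for b
    using restr_minus[of "T b" 0 g] by simp
  ultimately show ?thesis using p by (intro contentI[of _ q p]) simp_all
qed

lemma content_divide: "content x g \<Longrightarrow> content y h \<Longrightarrow> content (x / y) (g - h)"
  using content_mult[OF _ content_inverse, of x g y h] by (simp add: divide_inverse)

lemma content_uminus:
  assumes "content x g" shows "content (- x) g"
proof -
  obtain p q where p: "g \<in> G" "p \<in> Pol" "q \<in> Pol" "p \<noteq> 0" "q \<noteq> 0" "x = Fract p q"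
    "\<And>b. b \<in> B \<Longrightarrow> restr (T b) g = minval b p - minval b q" using assms(1) by (rule contentE) blast
  thus ?thesis by (intro contentI[of _ "- p" q]) (simp_all add: Pol_uminus)
qed

lemma content_one: "content 1 0"
  by (rule contentI[of _ 1 1]) (simp_all add: Pol_one One_fract_def)

lemma content_add:
  assumes "content x g" "content y h" "x + y \<noteq> 0"
  shows "\<exists>k. content (x + y) k \<and> (\<forall>b\<in>B. min (restr (T b) g) (restr (T b) h) \<le> restr (T b) k)"
proof -
  obtain p q where p: "g \<in> G" "p \<in> Pol" "q \<in> Pol" "p \<noteq> 0" "q \<noteq> 0" "x = Fract p q"
    "\<And>b. b \<in> B \<Longrightarrow> restr (T b) g = minval b p - minval b q" using assms(1) by (rule contentE) blast
  obtain p' q' where p': "h \<in> G" "p' \<in> Pol" "q' \<in> Pol" "p' \<noteq> 0" "q' \<noteq> 0" "y = Fract p' q'"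
    "\<And>b. b \<in> B \<Longrightarrow> restr (T b) h = minval b p' - minval b q'" using assms(2) by (rule contentE) blast
  define n where "n = p * q' + p' * q"
  define d where "d = q * q'"
  have xy: "x + y = Fract n d" using p p' by (simp add: n_def d_def)
  have d: "d \<noteq> 0" "d \<in> Pol" using p p' by (simp_all add: d_def Pol_mult)
  have "n \<noteq> 0" using assms(3) xy d by (auto simp: Zero_fract_def eq_fract)
  moreover have "n \<in> Pol" using p p' by (simp add: n_def Pol_mult Pol_add)
  ultimately obtain k where k: "content (Fract n d) k" "\<forall>b\<in>B. restr (T b) k = minval b n - minval b d"
    using content_Fract_exists d by blast
  have "min (restr (T b) g) (restr (T b) h) \<le> restr (T b) k" if b: "b \<in> B" for b
  proof -
    have "min (minval b p + minval b q') (minval b p' + minval b q) \<le> minval b n"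
      using minval_add[of "p * q'" "p' * q" b] \<open>n \<noteq> 0\<close> p p' by (simp add: n_def minval_mult)
    moreover have "minval b d = minval b q + minval b q'" using p p' by (simp add: d_def minval_mult)
    moreover have "restr (T b) g + (minval b q + minval b q') = minval b p + minval b q'"
      "restr (T b) h + (minval b q + minval b q') = minval b p' + minval b q"
      unfolding p(7)[OF b] p'(7)[OF b] by (simp_all add: algebra_simps)
    moreover have "restr (T b) k + minval b d = minval b n" using k(2) b by simp
    ultimately show ?thesis by (metis add_le_cancel_right min_le_iff_disj)
  qed
  thus ?thesis using k(1) xy by auto
qed

text \<open>The meet is realised by a sum of two monomials with exponents \<open>g\<close> and
  \<open>h\<close>, whose minimum on each chain is the smaller of the two restrictions. This is the
  source of the Bezout property.\<close>

lemma content_meet: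
  assumes "g \<in> G" "h \<in> G"
  shows "\<exists>x1 y1 k. content x1 g \<and> content y1 h \<and> content (x1 + y1) k \<and>
    (\<forall>b\<in>B. restr (T b) k = min (restr (T b) g) (restr (T b) h))"
proof -
  define n :: "('v \<Rightarrow>\<^sub>0 rat) \<Rightarrow>\<^sub>0 int" where "n = single g 1 + single h 1"
  \<comment> \<open>Nothing cancels even for \<open>g = h\<close>, where the coefficient is
    2.\<close>
  have keys_n: "keys n = {g, h}"
    by (auto simp: n_def in_keys_iff lookup_add lookup_single when_def split: if_splits)
  hence n0: "n \<noteq> 0" by auto
  have x1: "content (Fract (single g' 1) 1) g'" if "g' \<in> G" for g'
  proof (rule contentI[of _ "single g' 1" 1])
    have "lookup (single g' 1) g' \<noteq> (0::int)" by simp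
    thus "single g' 1 \<noteq> (0 :: ('v \<Rightarrow>\<^sub>0 rat) \<Rightarrow>\<^sub>0 int)" by (metis lookup_zero)
  qed (use that in \<open>auto simp: Pol_single Pol_one minval_def\<close>)
  have "n \<in> Pol" using assms by (simp add: n_def Pol_add Pol_single)
  then obtain k where k: "content (Fract n 1) k" "\<forall>b\<in>B. restr (T b) k = minval b n - minval b 1"
    using content_Fract_exists n0 Pol_one by (metis one_neq_zero)
  have "Fract n 1 = Fract (single g 1) 1 + Fract (single h 1) 1" by (simp add: n_def)
  moreover have "minval b n = min (restr (T b) g) (restr (T b) h)" for b
    by (simp add: minval_def keys_n)
  ultimately show ?thesis using x1 assms k by (metis diff_zero minval_one)
qed

definition domset :: "(('v \<Rightarrow>\<^sub>0 rat) \<Rightarrow>\<^sub>0 int) fract set" where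
  "domset = {x. x = 0 \<or> (\<exists>g. content x g \<and> nonneg g)}"

lemma domset_one: "1 \<in> domset"
  using content_one by (auto simp: domset_def)

lemma domset_uminus: "x \<in> domset \<Longrightarrow> - x \<in> domset"
  using content_uminus by (auto simp: domset_def)

lemma domset_mult: "x \<in> domset \<Longrightarrow> y \<in> domset \<Longrightarrow> x * y \<in> domset"
  using content_mult nonneg_add by (force simp: domset_def)

lemma domset_add:
  assumes "x \<in> domset" "y \<in> domset" shows "x + y \<in> domset"
proof (cases "x = 0 \<or> y = 0 \<or> x + y = 0")
  case False
  then obtain g h where gh: "content x g" "nonneg g" "content y h" "nonneg h"
    using assms by (auto simp: domset_def)
  then obtain k where k: "content (x + y) k" "\<forall>b\<in>B. min (restr (T b) g) (restr (T b) h) \<le> restr (T b) k"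
    using content_add[of x g y h] False by blast
  have "nonneg k" unfolding nonneg_def
  proof
    fix b assume b: "b \<in> B"
    have "0 \<le> min (restr (T b) g) (restr (T b) h)" using gh b by (simp add: nonneg_def)
    thus "0 \<le> restr (T b) k" using k(2) b order_trans by blast
  qed
  thus ?thesis using k(1) by (auto simp: domset_def)
next
  case True
  thus ?thesis using assms by (auto simp: domset_def)
qed

end

text \<open>The fractions form a type of their own, while the ring is wanted on
  \<open>'c list\<close>; the operations are carried over along an injection.\<close>

definition transported_ring :: "('k::idom \<Rightarrow> 'r) \<Rightarrow> 'k set \<Rightarrow> 'r ring" where
  "transported_ring f S = \<lparr>carrier = f ` S, monoid.mult = (\<lambda>x y. f (inv_into UNIV f x * inv_into UNIV f y)), one = f 1,
     ring.zero = f 0, ring.add = (\<lambda>x y. f (inv_into UNIV f x + inv_into UNIV f y))\<rparr>"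

lemma transported_ring_simps:
  assumes "inj f"
  shows "carrier (transported_ring f S) = f ` S" "\<one>\<^bsub>transported_ring f S\<^esub> = f 1"
    "\<zero>\<^bsub>transported_ring f S\<^esub> = f 0" "f x \<otimes>\<^bsub>transported_ring f S\<^esub> f y = f (x * y)"
    "f x \<oplus>\<^bsub>transported_ring f S\<^esub> f y = f (x + y)"
  using assms by (simp_all add: transported_ring_def)

lemma domain_transported_ring:
  fixes f :: "'k::idom \<Rightarrow> 'r"
  assumes f: "inj f" and S: "0 \<in> S" "1 \<in> S" "\<And>x. x \<in> S \<Longrightarrow> - x \<in> S"
    "\<And>x y. x \<in> S \<Longrightarrow> y \<in> S \<Longrightarrow> x + y \<in> S" "\<And>x y. x \<in> S \<Longrightarrow> y \<in> S \<Longrightarrow> x * y \<in> S"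
  shows "domain (transported_ring f S)"
proof (rule domainI)
  note simps = transported_ring_simps[OF f]
  show "cring (transported_ring f S)"
  proof (rule cringI)
    show "abelian_group (transported_ring f S)"
    proof (rule abelian_groupI)
      fix x assume "x \<in> carrier (transported_ring f S)"
      then obtain x' where "x = f x'" "x' \<in> S" by (auto simp: simps)
      thus "\<exists>y\<in>carrier (transported_ring f S). y \<oplus>\<^bsub>transported_ring f S\<^esub> x = \<zero>\<^bsub>transported_ring f S\<^esub>"
        using S(3) by (intro bexI[of _ "f (- x')"]) (auto simp: simps)
    qed (auto simp: simps S algebra_simps)
    show "Group.comm_monoid (transported_ring f S)"
      by (rule comm_monoidI) (auto simp: simps S algebra_simps)
  qed (auto simp: simps S algebra_simps)
  show "\<one>\<^bsub>transported_ring f S\<^esub> \<noteq> \<zero>\<^bsub>transported_ring f S\<^esub>"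
    using f by (simp add: simps inj_eq)
  show "a = \<zero>\<^bsub>transported_ring f S\<^esub> \<or> b = \<zero>\<^bsub>transported_ring f S\<^esub>"
    if "a \<otimes>\<^bsub>transported_ring f S\<^esub> b = \<zero>\<^bsub>transported_ring f S\<^esub>"
      "a \<in> carrier (transported_ring f S)" "b \<in> carrier (transported_ring f S)" for a b
    using that f by (auto simp: simps inj_eq)
qed

context root_forest
begin

lemma forest_semivaluation_transported:
  fixes f :: "(('v \<Rightarrow>\<^sub>0 rat) \<Rightarrow>\<^sub>0 int) fract \<Rightarrow> 'r"
  assumes f: "inj f"
  shows "forest_semivaluation V A B T (transported_ring f domset) (\<lambda>x. THE g. content (inv_into UNIV f x) g)"
proof -
  define \<phi> where "\<phi> x = (THE g. content (inv_into UNIV f x) g)" for x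
  define R where "R = transported_ring f domset"
  note simps = transported_ring_simps[OF f, of domset, folded R_def]
  have zero: "0 \<in> domset" by (simp add: domset_def)
  have dom: "domain R" unfolding R_def
    using zero by (intro domain_transported_ring f domset_one domset_uminus domset_add domset_mult)
  have phi: "\<phi> (f x) = g" if "content x g" for x g
    unfolding \<phi>_def using that f content_unique by (intro the_equality) auto
  have elim: thesis
    if "x \<in> carrier R - {\<zero>\<^bsub>R\<^esub>}" "\<And>x' g. x = f x' \<Longrightarrow> x' \<in> domset \<Longrightarrow> content x' g \<Longrightarrow> nonneg g \<Longrightarrow> \<phi> x = g \<Longrightarrow> thesis" for x thesis
    using that phi f by (auto simp: simps domset_def inj_eq)
  have intro: "f x \<in> carrier R - {\<zero>\<^bsub>R\<^esub>}" if "content x g" "nonneg g" for x g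
    using that f content_nonzero[of x g] by (auto simp: simps domset_def inj_eq)
  have dvd: "f x divides\<^bsub>R\<^esub> f y" if "content x g" "content y h" "nonneg (h - g)" for x y g h
  proof -
    have "y / x \<in> domset" using that content_divide[of y h x g] by (auto simp: domset_def)
    moreover have "y = x * (y / x)" using content_nonzero[OF that(1)] by simp
    ultimately show ?thesis unfolding factor_def by (intro bexI[of _ "f (y / x)"]) (auto simp: simps)
  qed
  have "forest_semivaluation V A B T R \<phi>"
  proof (intro forest_semivaluation.intro forest_semivaluation_axioms.intro)
    show "root_forest V A B T" by (rule root_forest_axioms)
    show "domain R" by (rule dom)
    fix x assume x: "x \<in> carrier R - {\<zero>\<^bsub>R\<^esub>}"
    obtain x' g where x': "x = f x'" "x' \<in> domset" "content x' g" "nonneg g" "\<phi> x = g"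
      using x by (rule elim)
    show "\<phi> x \<in> G" using x' by (auto elim: contentE)
    show "nonneg (\<phi> x)" using x' by simp
    fix y assume y: "y \<in> carrier R - {\<zero>\<^bsub>R\<^esub>}"
    obtain y' h where y': "y = f y'" "y' \<in> domset" "content y' h" "nonneg h" "\<phi> y = h"
      using y by (rule elim)
    show "\<phi> (x \<otimes>\<^bsub>R\<^esub> y) = \<phi> x + \<phi> y"
      using phi[OF content_mult[OF x'(3) y'(3)]] x' y' by (simp add: simps)
    show "min (restr (T b) (\<phi> x)) (restr (T b) (\<phi> y)) \<le> restr (T b) (\<phi> (x \<oplus>\<^bsub>R\<^esub> y))"
      if "x \<oplus>\<^bsub>R\<^esub> y \<noteq> \<zero>\<^bsub>R\<^esub>" "b \<in> B" for b
    proof -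
      have "x' + y' \<noteq> 0" using that x' y' by (auto simp: simps)
      then obtain k where "content (x' + y') k"
        "\<forall>b\<in>B. min (restr (T b) g) (restr (T b) h) \<le> restr (T b) k"
        using content_add[OF x'(3) y'(3)] by blast
      thus ?thesis using phi that x' y' by (simp add: simps)
    qed
    show "x divides\<^bsub>R\<^esub> y" if "nonneg (\<phi> y - \<phi> x)"
      using dvd x' y' that by simp
    show "\<exists>c\<in>carrier R. \<exists>d\<in>carrier R. (c \<otimes>\<^bsub>R\<^esub> x \<oplus>\<^bsub>R\<^esub> d \<otimes>\<^bsub>R\<^esub> y) divides\<^bsub>R\<^esub> x \<and>
        (c \<otimes>\<^bsub>R\<^esub> x \<oplus>\<^bsub>R\<^esub> d \<otimes>\<^bsub>R\<^esub> y) divides\<^bsub>R\<^esub> y"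
    proof -
      have "g \<in> G" "h \<in> G" using x' y' by (auto elim: contentE)
      then obtain x1 y1 k where x1: "content x1 g" and y1: "content y1 h" and k: "content (x1 + y1) k"
        and min: "\<And>b. b \<in> B \<Longrightarrow> restr (T b) k = min (restr (T b) g) (restr (T b) h)"
        using content_meet by blast
      \<comment> \<open>These multipliers have value 0. They replace \<open>x\<close> and
        \<open>y\<close> by elements of the same values whose sum has the meet as its value; in the
        sum of \<open>x\<close> and \<open>y\<close> themselves the leading parts could
        cancel.\<close>
      have "x1 / x' \<in> domset" "y1 / y' \<in> domset"
        using content_divide[OF x1 x'(3)] content_divide[OF y1 y'(3)] nonneg_zero
        unfolding domset_def by auto
      hence "f (x1 / x') \<in> carrier R" "f (y1 / y') \<in> carrier R" by (auto simp: simps)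
      moreover have "f (x1 / x') \<otimes>\<^bsub>R\<^esub> x \<oplus>\<^bsub>R\<^esub> f (y1 / y') \<otimes>\<^bsub>R\<^esub> y = f (x1 + y1)"
        using content_nonzero[OF x'(3)] content_nonzero[OF y'(3)] x' y' by (simp add: simps)
      moreover have "nonneg (g - k)" "nonneg (h - k)"
        unfolding nonneg_def by (auto simp: restr_minus min)
      hence "f (x1 + y1) divides\<^bsub>R\<^esub> x" "f (x1 + y1) divides\<^bsub>R\<^esub> y"
        using dvd[OF k] x' y' by auto
      ultimately show ?thesis by metis
    qed
  next
    fix g assume g: "g \<in> G" "nonneg g"
    obtain x1 where x1: "content x1 g" using content_meet g by blast
    show "\<exists>x\<in>carrier R - {\<zero>\<^bsub>R\<^esub>}. \<phi> x = g"
      using intro[OF x1 g(2)] phi[OF x1] by blast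
  qed
  thus ?thesis by (simp add: R_def \<phi>_def[abs_def])
qed

end

section \<open>Cardinalities\<close>

text \<open>
  The order is the converse of a well-order: \<open>root_forest\<close> needs greatest elements, since the
  lexicographic order gives precedence to small indices.
\<close>
datatype 'c idx = Idx (un_idx: 'c)

instantiation idx :: (type) linorder
begin

definition less_eq_idx :: "'a idx \<Rightarrow> 'a idx \<Rightarrow> bool" where
  "x \<le> y \<longleftrightarrow> (un_idx y, un_idx x) \<in> |UNIV :: 'a set|"

definition less_idx :: "'a idx \<Rightarrow> 'a idx \<Rightarrow> bool" where
  "x < y \<longleftrightarrow> x \<le> y \<and> \<not> y \<le> x" for x y :: "'a idx"

instance
proof
  have "well_order_on UNIV |UNIV :: 'a set|" by (rule card_of_well_order_on)
  hence lin: "refl |UNIV :: 'a set|" "trans |UNIV :: 'a set|" "antisym |UNIV :: 'a set|"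
    "total |UNIV :: 'a set|"
    by (simp_all add: well_order_on_def linear_order_on_def partial_order_on_def preorder_on_def)
  fix x y z :: "'a idx"
  show "x \<le> x" using lin(1) by (simp add: less_eq_idx_def refl_on_def)
  show "x \<le> y \<Longrightarrow> y \<le> z \<Longrightarrow> x \<le> z" using lin(2) unfolding less_eq_idx_def by (meson transD)
  show "x \<le> y \<Longrightarrow> y \<le> x \<Longrightarrow> x = y"
    using lin(3) unfolding less_eq_idx_def by (meson antisymD idx.expand)
  show "x \<le> y \<or> y \<le> x"
    using lin(1,4) unfolding less_eq_idx_def total_on_def refl_on_def by (metis UNIV_I)
qed (simp add: less_idx_def)

end

lemma idx_greatest:
  fixes S :: "'c idx set"
  assumes "S \<noteq> {}" shows "\<exists>m\<in>S. \<forall>s\<in>S. s \<le> m"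
proof -
  have "wf ( |UNIV :: 'c set| - Id)"
    using card_of_well_order_on[of "UNIV :: 'c set"] by (simp add: well_order_on_def)
  moreover obtain x where "x \<in> un_idx ` S" using assms by blast
  ultimately obtain z where z: "z \<in> un_idx ` S"
    "\<And>y. (y, z) \<in> |UNIV :: 'c set| - Id \<Longrightarrow> y \<notin> un_idx ` S" by (rule wfE_min) blast
  then obtain m where m: "m \<in> S" "z = un_idx m" by blast
  have "s \<le> m" if "s \<in> S" for s
  proof (rule ccontr)
    assume "\<not> s \<le> m"
    hence "m \<le> s" "m \<noteq> s" by auto
    hence "(un_idx s, z) \<in> |UNIV :: 'c set| - Id" using m by (auto simp: less_eq_idx_def idx.expand)
    thus False using z(2) that by blast
  qed
  thus ?thesis using m by blast
qed

section \<open>Injections into an infinite type\<close>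

lemma inj_pairing:
  assumes "infinite (UNIV :: 'l set)" shows "\<exists>h :: 'l \<times> 'l \<Rightarrow> 'l. inj h"
proof -
  have "|(UNIV :: 'l set) \<times> (UNIV :: 'l set)| \<le>o |UNIV :: 'l set|"
    using card_of_Times_same_infinite[OF assms] by (rule ordIso_imp_ordLeq)
  then obtain h :: "'l \<times> 'l \<Rightarrow> 'l" where "inj_on h (UNIV \<times> UNIV)"
    unfolding card_of_ordLeq[symmetric] by blast
  thus ?thesis by auto
qed

lemma inj_list:
  fixes e :: "'a \<Rightarrow> 'l"
  assumes inf: "infinite (UNIV :: 'l set)" and e: "inj e"
  shows "\<exists>g :: 'a list \<Rightarrow> 'l. inj g"
proof -
  obtain h :: "'l \<times> 'l \<Rightarrow> 'l" where h: "inj h" using inj_pairing[OF inf] by blast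
  obtain i :: "nat \<Rightarrow> 'l" where i: "inj i" using infinite_countable_subset[OF inf] by blast
  define enc where "enc xs = foldr (\<lambda>x y. h (e x, y)) xs undefined" for xs
  have "length xs = length ys \<Longrightarrow> enc xs = enc ys \<Longrightarrow> xs = ys" for xs ys
    by (induction xs ys rule: list_induct2) (simp_all add: enc_def inj_eq[OF h] inj_eq[OF e])
  \<comment> \<open>\<open>enc\<close> is known to separate only lists of equal length, so the
    length is recorded alongside.\<close>
  hence "inj (\<lambda>xs. h (i (length xs), enc xs))"
    by (intro injI) (simp add: inj_eq[OF h] inj_eq[OF i])
  thus ?thesis by blast
qed

text \<open>A finitely supported function is recovered from a list enumerating its graph over the
  keys.\<close>

lemma inj_poly_mapping:
  fixes e :: "'k \<Rightarrow> 'l" and e' :: "'b::zero \<Rightarrow> 'l"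
  assumes inf: "infinite (UNIV :: 'l set)" and e: "inj e" "inj e'"
  shows "\<exists>g :: ('k \<Rightarrow>\<^sub>0 'b) \<Rightarrow> 'l. inj g"
proof -
  obtain h :: "'l \<times> 'l \<Rightarrow> 'l" where h: "inj h" using inj_pairing[OF inf] by blast
  have "inj (\<lambda>(k, c). h (e k, e' c))"
    by (rule injI) (auto simp: inj_eq[OF h] inj_eq[OF e(1)] inj_eq[OF e(2)])
  then obtain g :: "('k \<times> 'b) list \<Rightarrow> 'l" where g: "inj g" using inj_list[OF inf] by blast
  define L where "L p = (SOME xs. set xs = (\<lambda>k. (k, lookup p k)) ` keys p)" for p :: "'k \<Rightarrow>\<^sub>0 'b"
  have L: "set (L p) = (\<lambda>k. (k, lookup p k)) ` keys p" for p
    unfolding L_def by (rule someI_ex) (intro finite_list finite_imageI finite_keys)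
  have "p = q" if "L p = L q" for p q
  proof -
    have "(\<lambda>k. (k, lookup p k)) ` keys p = (\<lambda>k. (k, lookup q k)) ` keys q"
      using that L by metis
    hence "(k \<in> keys p \<and> c = lookup p k) \<longleftrightarrow> (k \<in> keys q \<and> c = lookup q k)" for k c
      by (auto simp: set_eq_iff image_iff)
    thus ?thesis by (intro poly_mapping_eqI) (metis in_keys_iff)
  qed
  hence "inj L" by (simp add: inj_def)
  thus ?thesis using g inj_compose by blast
qed

lemma inj_fract:
  fixes e :: "'k::idom \<Rightarrow> 'l"
  assumes inf: "infinite (UNIV :: 'l set)" and e: "inj e"
  shows "\<exists>g :: 'k fract \<Rightarrow> 'l. inj g"
proof -
  obtain h :: "'l \<times> 'l \<Rightarrow> 'l" where h: "inj h" using inj_pairing[OF inf] by blast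
  have "\<exists>p q. x = Fract p q" for x :: "'k fract" by (cases x) blast
  then obtain n d where nd: "\<And>x :: 'k fract. x = Fract (n x) (d x)" by metis
  have "inj (\<lambda>x. h (e (n x), e (d x)))"
  proof (rule injI)
    fix x y assume "h (e (n x), e (d x)) = h (e (n y), e (d y))"
    hence "n x = n y" "d x = d y" by (simp_all add: inj_eq[OF h] inj_eq[OF e])
    thus "x = y" using nd[of x] nd[of y] by simp
  qed
  thus ?thesis by blast
qed

text \<open>Lists form an infinite type even over a finite \<open>'c\<close>, so
  \<open>'c list\<close> absorbs the countable coefficients, the finitely supported functions and
  the fractions.\<close>

lemma inj_fract_idx_list:
  "\<exists>f :: (('c idx \<Rightarrow>\<^sub>0 rat) \<Rightarrow>\<^sub>0 int) fract \<Rightarrow> 'c list. inj f"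
proof -
  have inf: "infinite (UNIV :: 'c list set)" by (rule infinite_UNIV_listI)
  obtain i :: "nat \<Rightarrow> 'c list" where i: "inj i" using infinite_countable_subset[OF inf] by blast
  have iq: "inj (\<lambda>q::rat. i (to_nat q))" and iz: "inj (\<lambda>n::int. i (to_nat n))"
    by (auto intro!: injI simp: inj_eq[OF i])
  have "inj (\<lambda>x :: 'c idx. [un_idx x])" by (rule injI) (simp add: idx.expand)
  then obtain g :: "('c idx \<Rightarrow>\<^sub>0 rat) \<Rightarrow> 'c list" where "inj g"
    using inj_poly_mapping[OF inf _ iq] by blast
  then obtain g' :: "(('c idx \<Rightarrow>\<^sub>0 rat) \<Rightarrow>\<^sub>0 int) \<Rightarrow> 'c list" where "inj g'"
    using inj_poly_mapping[OF inf _ iz] by blast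
  thus ?thesis by (rule inj_fract[OF inf])
qed

section \<open>Choice of the index sets\<close>

lemma ordLeq_subset:
  assumes "Card_order r" "r \<le>o |S|" shows "\<exists>D\<subseteq>S. |D| =o r"
proof -
  have "|Field r| \<le>o |S|" using assms card_of_Field_ordIso ordIso_ordLeq_trans by blast
  then obtain D where "D \<subseteq> S" "|Field r| =o |D|" by (auto simp: internalize_card_of_ordLeq2[of "Field r"])
  thus ?thesis using assms card_of_Field_ordIso ordIso_symmetric ordIso_transitive by blast
qed

text \<open>For infinite sets cardinality does not decide whether \<open>A = B\<close> or
  \<open>A = V\<close>, so both equivalences are built into the choice. \<open>v0\<close> is kept in
  \<open>B\<close> as the future root of the long chain.\<close>

lemma choose_forest_sets:
  fixes \<alpha> :: "'a rel" and \<beta> :: "'b rel" and \<gamma> :: "'c rel" and V :: "'v set"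
  assumes co: "Card_order \<alpha>" "Card_order \<beta>" "Card_order \<gamma>"
    and le: "cone \<le>o \<alpha>" "\<alpha> \<le>o \<beta>" "\<beta> \<le>o \<gamma>" and V: "|V| =o \<gamma>" and v0: "v0 \<in> V"
  obtains A B where "A \<subseteq> B" "B \<subseteq> V" "v0 \<in> B" "|A| =o \<alpha>" "|B| =o \<beta>" "A = B \<longleftrightarrow> \<alpha> =o \<beta>"
    "A = V \<longleftrightarrow> \<alpha> =o \<beta> \<and> \<beta> =o \<gamma> \<and> \<gamma> <o natLeq"
proof -
  have \<beta>V: "\<beta> \<le>o |V|" using le(3) V ordIso_symmetric ordLeq_ordIso_trans by blast
  have "\<exists>B\<subseteq>V. v0 \<in> B \<and> |B| =o \<beta> \<and> (B = V \<longleftrightarrow> \<beta> =o \<gamma> \<and> finite V)"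
  proof (cases "\<beta> =o \<gamma>")
    case True
    hence V\<beta>: "|V| =o \<beta>" using V ordIso_symmetric ordIso_transitive by blast
    show ?thesis
    proof (cases "finite V")
      case fin: True
      thus ?thesis using V\<beta> True v0 by blast
    next
      case False
      hence "infinite (V - {v0})" by simp
      \<comment> \<open>For infinite \<open>V\<close> one point other than \<open>v0\<close> is
        dropped: the cardinality stays, but \<open>B\<close> becomes a proper subset.\<close>
      then obtain v1 where v1: "v1 \<in> V" "v1 \<noteq> v0" using infinite_imp_nonempty by blast
      obtain h where "bij_betw h V (V - {v1})" using infinite_imp_bij_betw[OF False] by blast
      hence "|V - {v1}| =o |V|" using card_of_ordIsoI ordIso_symmetric by blast
      hence "|V - {v1}| =o \<beta>" using V\<beta> ordIso_transitive by blast
      thus ?thesis using v1 v0 False by (intro exI[of _ "V - {v1}"]) auto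
    qed
  next
    case False
    obtain D where D: "D \<subseteq> V" "|D| =o \<beta>" using ordLeq_subset[OF co(2) \<beta>V] by blast
    have "cone \<le>o \<beta>" using le ordLeq_transitive by blast
    hence "cone \<le>o |D|" using D(2) ordIso_symmetric ordLeq_ordIso_trans by blast
    hence "D \<noteq> {}" unfolding cone_def by (metis card_of_empty3 insert_not_empty)
    then obtain d where d: "d \<in> D" by blast
    \<comment> \<open>The transposition of \<open>v0\<close> and \<open>d\<close> moves
      \<open>D\<close> to a set of the same size that contains \<open>v0\<close>.\<close>
    define \<tau> where "\<tau> x = (if x = v0 then d else if x = d then v0 else x)" for x
    have "inj_on \<tau> D" by (auto simp: inj_on_def \<tau>_def split: if_splits)
    hence "|D| =o |\<tau> ` D|" using card_of_ordIsoI by (metis inj_on_imp_bij_betw)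
    hence card: "|\<tau> ` D| =o \<beta>" using D(2) ordIso_symmetric ordIso_transitive by blast
    have "\<tau> ` D \<noteq> V"
    proof
      assume "\<tau> ` D = V"
      hence "\<beta> =o \<gamma>" using card V ordIso_symmetric ordIso_transitive by metis
      thus False using False by simp
    qed
    moreover have "\<tau> ` D \<subseteq> V" "v0 \<in> \<tau> ` D" using D d v0 by (auto simp: \<tau>_def image_iff)
    ultimately show ?thesis using card False by blast
  qed
  then obtain B where B: "B \<subseteq> V" "v0 \<in> B" "|B| =o \<beta>" "B = V \<longleftrightarrow> \<beta> =o \<gamma> \<and> finite V" by blast
  have "\<exists>A\<subseteq>B. |A| =o \<alpha> \<and> (A = B \<longleftrightarrow> \<alpha> =o \<beta>)"
  proof (cases "\<alpha> =o \<beta>")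
    case True
    hence "|B| =o \<alpha>" using B(3) ordIso_symmetric ordIso_transitive by blast
    thus ?thesis using True by blast
  next
    case False
    have "\<alpha> \<le>o |B|" using le(2) B(3) ordIso_symmetric ordLeq_ordIso_trans by blast
    then obtain A where A: "A \<subseteq> B" "|A| =o \<alpha>" using ordLeq_subset[OF co(1)] by blast
    have "A \<noteq> B"
    proof
      assume "A = B"
      hence "\<alpha> =o \<beta>" using A B(3) ordIso_symmetric ordIso_transitive by metis
      thus False using False by simp
    qed
    thus ?thesis using A False by blast
  qed
  then obtain A where A: "A \<subseteq> B" "|A| =o \<alpha>" "A = B \<longleftrightarrow> \<alpha> =o \<beta>" by blast
  have "finite V \<longleftrightarrow> \<gamma> <o natLeq"
    using finite_iff_ordLess_natLeq[of V] V ordIso_symmetric ordIso_ordLess_trans by metis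
  hence "A = V \<longleftrightarrow> \<alpha> =o \<beta> \<and> \<beta> =o \<gamma> \<and> \<gamma> <o natLeq" using A B by blast
  thus ?thesis using that A B by blast
qed

text \<open>
  One tree is the chain of \<open>v0\<close> together with everything outside \<open>B\<close>; all other trees are single
  vertices.
\<close>
lemma root_forest_chain:
  fixes V A B :: "'c idx set"
  assumes "A \<subseteq> B" "B \<subseteq> V" "v0 \<in> B" "\<And>v. v \<in> V \<Longrightarrow> v \<le> v0"
  shows "root_forest V A B (\<lambda>v. if v \<in> B - {v0} then {v} else {w \<in> insert v0 (V - B). w \<le> v})"
proof
  fix v assume v: "v \<in> V"
  show "\<exists>b\<in>B. v \<in> (if b \<in> B - {v0} then {b} else {w \<in> insert v0 (V - B). w \<le> b})"
  proof (cases "v \<in> B - {v0}")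
    case True
    thus ?thesis by (intro bexI[of _ v]) auto
  next
    case False
    thus ?thesis using assms v by (intro bexI[of _ v0]) auto
  qed
next
  fix S :: "'c idx set" assume "S \<noteq> {}"
  thus "\<exists>m\<in>S. \<forall>s\<in>S. s \<le> m" by (rule idx_greatest)
qed (use assms in \<open>auto split: if_splits intro: order_trans[of _ v0]\<close>)

lemma card_of_inj_image: "inj_on f S \<Longrightarrow> |S| =o r \<Longrightarrow> |f ` S| =o r"
  using card_of_ordIsoI[OF inj_on_imp_bij_betw] ordIso_symmetric ordIso_transitive by blast

theorem theorem4p20:
  fixes \<alpha> :: "'a rel" and \<beta> :: "'b rel" and \<gamma> :: "'c rel"
  assumes "Card_order \<alpha>" and "Card_order \<beta>" and "Card_order \<gamma>"
    and "cone \<le>o \<alpha>" and "\<alpha> \<le>o \<beta>" and "\<beta> \<le>o \<gamma>"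
  shows "\<exists>R :: 'c list ring.
    domain R \<and>
    bezout_domain R \<and>
    ( |atoms R| =o \<alpha> \<and> (\<forall>I\<in>atoms R. maximalideal I R)) \<and>
    |maximal_ideals R| =o \<beta> \<and>
    |nonzero_prime_ideals R| =o \<gamma> \<and>
    (atomic_domain R \<longleftrightarrow> \<alpha> =o \<beta> \<and> \<beta> =o \<gamma> \<and> \<gamma> <o natLeq) \<and>
    (furstenberg_domain R \<longleftrightarrow> \<alpha> =o \<beta>) \<and>
    (semiprimitive R \<longleftrightarrow> natLeq \<le>o \<beta>)"
proof -
  \<comment> \<open>Here \<gamma> supplies only the size; the order on \<open>idx\<close> comes from
    a well-order of the whole type \<open>'c\<close>.\<close>
  define V where "V = Idx ` Field \<gamma>"
  have V: "|V| =o \<gamma>" unfolding V_def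
    by (rule card_of_inj_image[OF _ card_of_Field_ordIso[OF assms(3)]]) (simp add: inj_on_def)
  have "cone \<le>o \<gamma>" by (rule ordLeq_transitive[OF ordLeq_transitive[OF assms(4,5)] assms(6)])
  hence "cone \<le>o |V|" using V ordIso_symmetric ordLeq_ordIso_trans by blast
  hence "V \<noteq> {}" unfolding cone_def by (metis card_of_empty3 insert_not_empty)
  \<comment> \<open>The greatest index can close the long chain, since every index outside
    \<open>B\<close> precedes it.\<close>
  then obtain v0 where v0: "v0 \<in> V" "\<And>v. v \<in> V \<Longrightarrow> v \<le> v0" using idx_greatest[of V] by blast
  obtain A B where AB: "A \<subseteq> B" "B \<subseteq> V" "v0 \<in> B" "|A| =o \<alpha>" "|B| =o \<beta>" "A = B \<longleftrightarrow> \<alpha> =o \<beta>"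
    "A = V \<longleftrightarrow> \<alpha> =o \<beta> \<and> \<beta> =o \<gamma> \<and> \<gamma> <o natLeq"
    using choose_forest_sets[OF assms V v0(1)] by blast
  define T where "T v = (if v \<in> B - {v0} then {v} else {w \<in> insert v0 (V - B). w \<le> v})" for v
  interpret F: root_forest V A B T
    using root_forest_chain[OF AB(1-3) v0(2)] by (simp add: T_def[abs_def])
  obtain f :: "(('c idx \<Rightarrow>\<^sub>0 rat) \<Rightarrow>\<^sub>0 int) fract \<Rightarrow> 'c list" where f: "inj f"
    using inj_fract_idx_list[where 'c = 'c] by (elim exE)
  define R where "R = transported_ring f F.domset"
  interpret S: forest_semivaluation V A B T R "\<lambda>x. THE g. F.content (inv_into UNIV f x) g"
    unfolding R_def by (rule F.forest_semivaluation_transported[OF f])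
  have inj: "inj_on S.prime_at A" "inj_on S.prime_at B" "inj_on S.prime_at V"
    using AB(1,2) by (auto intro: inj_on_subset[OF S.inj_on_prime_at])
  have "infinite B \<longleftrightarrow> natLeq \<le>o \<beta>"
    using infinite_iff_natLeq_ordLeq[of B] ordLeq_ordIso_trans[OF _ AB(5), of natLeq]
      ordLeq_ordIso_trans[OF _ ordIso_symmetric[OF AB(5)], of natLeq] by auto
  hence "semiprimitive R \<longleftrightarrow> natLeq \<le>o \<beta>" using S.semiprimitive_iff[OF \<open>V \<noteq> {}\<close>] by simp
  moreover have "|atoms R| =o \<alpha>" unfolding S.atoms_eq using inj(1) AB(4) by (rule card_of_inj_image)
  moreover have "|maximal_ideals R| =o \<beta>" unfolding S.maximal_ideals_eq[OF \<open>V \<noteq> {}\<close>]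
    using inj(2) AB(5) by (rule card_of_inj_image)
  moreover have "|nonzero_prime_ideals R| =o \<gamma>" unfolding S.nonzero_prime_ideals_eq
    using inj(3) V by (rule card_of_inj_image)
  moreover have "\<forall>I\<in>atoms R. maximalideal I R"
    using S.maximalideal_prime_at AB(1) unfolding S.atoms_eq by blast
  moreover have "atomic_domain R \<longleftrightarrow> \<alpha> =o \<beta> \<and> \<beta> =o \<gamma> \<and> \<gamma> <o natLeq"
    using S.atomic_iff AB(7) by simp
  moreover have "furstenberg_domain R \<longleftrightarrow> \<alpha> =o \<beta>" using S.furstenberg_iff AB(6) by simp
  ultimately show ?thesis using S.bezout S.domain_axioms by (intro exI[of _ R]) blast
qed

end
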